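(* Let $B\in GL(d,\mathbb{Z})$ with $|\det B|\neq1$. Then the Gabor representation $\pi$ of $\widetilde G=\mathbb{Z}^d\times B\mathbb{Z}^d$ on $L^2(\mathbb{R}^d)$ is not admissible; that is, there is no Parseval frame of $L^2(\mathbb{R}^d)$ of the type $\pi(\widetilde G)f$. Moreover, the Gabor representation is unitarily equivalent to the direct integral $$\int_{\Lambda}^{\oplus}\chi_\varsigma\otimes\mathbf{1}_{\mathbb{C}^{|\det B|}}\,d\mu(\varsigma).$$
   Context: $GL(d,\mathbb{Z})$ denotes the set of nonsingular (over $\mathbb{R}$) $d\times d$ matrices with integer entries (the determinant need not be $\pm1$). On $L^2(\mathbb{R}^d)$, $T_kf(x)=f(x-k)$ and $M_lf(x)=e^{2\pi i\langle l,x\rangle}f(x)$. The Gabor representation is $\pi(k,l)=T_kM_l$, $(k,l)\in\widetilde G=\mathbb{Z}^d\times B\mathbb{Z}^d$. A unitary representation $\pi$ of a locally compact group $X$ on $H$ is admissible if there is $\phi\in H$ such that $W_\phi:H\to L^2(X)$, $W_\phi\psi(x)=\langle\psi,\pi(x)\phi\rangle$, is an isometry. A family $\{f_i\}$ is a Parseval frame for $\mathcal{H}$ if $\sum_i|\langle f,f_i\rangle|^2=\|f\|^2$ for all $f\in\mathcal{H}$. $\Lambda\subset\mathbb{R}^{2d}$ is a measurable fundamental domain for the lattice $\mathbb{Z}^d\times B^{-tr}\mathbb{Z}^d$ (with $B^{-tr}$ the inverse transpose of $B$), parametrizing the unitary dual of $\widetilde G$ via $\chi_{(x,y)}(k,l)=e^{2\pi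 i(\langle x,k\rangle+\langle y,l\rangle)}$, and $d\mu=|\det B|\,dx\,dy$ on $\Lambda$ is the Plancherel measure of $\widetilde G$. *)

theory Defs
  imports "HOL-Analysis.Analysis"
begin

(* A complex Hilbert space given by representatives: hinner is linear in the first argument
   and only positive semidefinite on hcarrier; vectors at distance 0 are identified (heq).
   This makes square-integrable functions themselves, rather than their almost-everywhere
   classes, the elements of L^2. *)
record 'v hilb =
  hcarrier :: "'v set"
  hadd :: "'v \<Rightarrow> 'v \<Rightarrow> 'v"
  hscale :: "complex \<Rightarrow> 'v \<Rightarrow> 'v"
  hinner :: "'v \<Rightarrow> 'v \<Rightarrow> complex"

definition hnorm :: "'v hilb \<Rightarrow> 'v \<Rightarrow> real" where
  "hnorm H v = sqrt (Re (hinner H v v))"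

definition heq :: "'v hilb \<Rightarrow> 'v \<Rightarrow> 'v \<Rightarrow> bool" where
  "heq H v w \<longleftrightarrow> hnorm H (hadd H v (hscale H (-1) w)) = 0"

definition L2 :: "'a measure \<Rightarrow> ('a \<Rightarrow> complex) hilb" where
  "L2 M = \<lparr> hcarrier = {f \<in> borel_measurable M. integrable M (\<lambda>x. (cmod (f x))\<^sup>2)},
            hadd = (\<lambda>f g x. f x + g x),
            hscale = (\<lambda>c f x. c * f x),
            hinner = (\<lambda>f g. LINT x|M. f x * cnj (g x)) \<rparr>"

lemma heq_L2:
  assumes "f \<in> hcarrier (L2 M)" "g \<in> hcarrier (L2 M)"
  shows "heq (L2 M) f g \<longleftrightarrow> (AE x in M. f x = g x)"
proof -
  have [measurable]: "f \<in> borel_measurable M" "g \<in> borel_measurable M"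
    and i: "integrable M (\<lambda>x. (cmod (f x))\<^sup>2)" "integrable M (\<lambda>x. (cmod (g x))\<^sup>2)"
    using assms by (auto simp: L2_def)
  have bound: "(cmod (a - b))\<^sup>2 \<le> 2 * (cmod a)\<^sup>2 + 2 * (cmod b)\<^sup>2" for a b
  proof -
    have "(cmod (a - b))\<^sup>2 \<le> (cmod a + cmod b)\<^sup>2"
      by (intro power_mono norm_triangle_ineq4) auto
    also have "\<dots> \<le> 2 * (cmod a)\<^sup>2 + 2 * (cmod b)\<^sup>2"
      using sum_squares_bound[of "cmod a" "cmod b"] by (simp add: power2_sum)
    finally show ?thesis .
  qed
  have int: "integrable M (\<lambda>x. (cmod (f x - g x))\<^sup>2)"
  proof (rule Bochner_Integration.integrable_bound)
    show "integrable M (\<lambda>x. 2 * (cmod (f x))\<^sup>2 + 2 * (cmod (g x))\<^sup>2)"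
      using i by simp
    show "AE x in M. norm ((cmod (f x - g x))\<^sup>2) \<le> norm (2 * (cmod (f x))\<^sup>2 + 2 * (cmod (g x))\<^sup>2)"
      using bound by simp
  qed measurable
  have "(LINT x|M. (f x - g x) * cnj (f x - g x)) =
      (LINT x|M. complex_of_real ((cmod (f x - g x))\<^sup>2))"
    by (simp only: complex_norm_square)
  also have "\<dots> = complex_of_real (LINT x|M. (cmod (f x - g x))\<^sup>2)"
    by (rule integral_complex_of_real)
  finally have "heq (L2 M) f g \<longleftrightarrow> (LINT x|M. (cmod (f x - g x))\<^sup>2) = 0"
    by (simp add: heq_def hnorm_def L2_def)
  also have "\<dots> \<longleftrightarrow> (AE x in M. (cmod (f x - g x))\<^sup>2 = 0)"
    by (rule integral_nonneg_eq_0_iff_AE[OF int]) auto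
  finally show ?thesis by simp
qed

definition cspace :: "nat \<Rightarrow> (nat \<Rightarrow> complex) hilb" where
  "cspace N = \<lparr> hcarrier = {v. \<forall>i\<ge>N. v i = 0},
                hadd = (\<lambda>v w i. v i + w i),
                hscale = (\<lambda>c v i. c * v i),
                hinner = (\<lambda>v w. \<Sum>i<N. v i * cnj (w i)) \<rparr>"

(* Direct integral over \<mu> of the constant field of Hilbert spaces with fibre H;
   the measurable vector fields are the weakly measurable ones. *)
definition direct_integral :: "'a measure \<Rightarrow> 'v hilb \<Rightarrow> ('a \<Rightarrow> 'v) hilb" where
  "direct_integral \<mu> H =
    \<lparr> hcarrier = {F. (\<forall>s\<in>space \<mu>. F s \<in> hcarrier H) \<and>
                     (\<forall>v\<in>hcarrier H. (\<lambda>s. hinner H (F s) v) \<in> borel_measurable \<mu>) \<and>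
                     integrable \<mu> (\<lambda>s. (hnorm H (F s))\<^sup>2)},
      hadd = (\<lambda>F G s. hadd H (F s) (G s)),
      hscale = (\<lambda>c F s. hscale H c (F s)),
      hinner = (\<lambda>F G. LINT s|\<mu>. hinner H (F s) (G s)) \<rparr>"

definition direct_integral_rep ::
  "('a \<Rightarrow> 'g \<Rightarrow> 'v \<Rightarrow> 'v) \<Rightarrow> 'g \<Rightarrow> ('a \<Rightarrow> 'v) \<Rightarrow> ('a \<Rightarrow> 'v)" where
  "direct_integral_rep \<rho> g F = (\<lambda>s. \<rho> s g (F s))"

(* The representation \<xi> \<otimes> 1_H of a character \<xi>, on \<complex> \<otimes> H = H. *)
definition character_tensor_one :: "'v hilb \<Rightarrow> ('g \<Rightarrow> complex) \<Rightarrow> 'g \<Rightarrow> 'v \<Rightarrow> 'v" where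
  "character_tensor_one H \<xi> g v = hscale H (\<xi> g) v"

definition isometry :: "'v hilb \<Rightarrow> 'w hilb \<Rightarrow> ('v \<Rightarrow> 'w) \<Rightarrow> bool" where
  "isometry H K U \<longleftrightarrow>
     (\<forall>v\<in>hcarrier H. U v \<in> hcarrier K) \<and>
     (\<forall>v\<in>hcarrier H. \<forall>w\<in>hcarrier H. heq K (U (hadd H v w)) (hadd K (U v) (U w))) \<and>
     (\<forall>c. \<forall>v\<in>hcarrier H. heq K (U (hscale H c v)) (hscale K c (U v))) \<and>
     (\<forall>v\<in>hcarrier H. hnorm K (U v) = hnorm H v)"

definition unitary :: "'v hilb \<Rightarrow> 'w hilb \<Rightarrow> ('v \<Rightarrow> 'w) \<Rightarrow> bool" where
  "unitary H K U \<longleftrightarrow>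
     isometry H K U \<and> (\<forall>w\<in>hcarrier K. \<exists>v\<in>hcarrier H. heq K (U v) w)"

definition unitarily_equivalent ::
  "'g set \<Rightarrow> 'v hilb \<Rightarrow> ('g \<Rightarrow> 'v \<Rightarrow> 'v) \<Rightarrow> 'w hilb \<Rightarrow> ('g \<Rightarrow> 'w \<Rightarrow> 'w) \<Rightarrow> bool" where
  "unitarily_equivalent G H \<pi> K \<rho> \<longleftrightarrow>
     (\<exists>U. unitary H K U \<and>
        (\<forall>g\<in>G. \<forall>v\<in>hcarrier H. heq K (U (\<pi> g v)) (\<rho> g (U v))))"

(* \<nu> is the Haar measure of the group on which \<pi> is defined. *)
definition admissible :: "'g measure \<Rightarrow> 'v hilb \<Rightarrow> ('g \<Rightarrow> 'v \<Rightarrow> 'v) \<Rightarrow> bool" where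
  "admissible \<nu> H \<pi> \<longleftrightarrow>
     (\<exists>\<phi>\<in>hcarrier H. isometry H (L2 \<nu>) (\<lambda>\<psi> x. hinner H \<psi> (\<pi> x \<phi>)))"

definition parseval_frame :: "'v hilb \<Rightarrow> 'i set \<Rightarrow> ('i \<Rightarrow> 'v) \<Rightarrow> bool" where
  "parseval_frame H I f \<longleftrightarrow>
     (\<forall>i\<in>I. f i \<in> hcarrier H) \<and>
     (\<forall>v\<in>hcarrier H. ((\<lambda>i. (cmod (hinner H v (f i)))\<^sup>2) has_sum (hnorm H v)\<^sup>2) I)"

definition int_vecs :: "(real ^ 'd) set" where
  "int_vecs = {k. \<forall>i. k $ i \<in> \<int>}"

(* Integer matrices that are nonsingular over the reals; det = 1 or -1 is not required. *)
definition GL_int :: "(real ^ 'd ^ 'd) set" where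
  "GL_int = {B. (\<forall>i j. B $ i $ j \<in> \<int>) \<and> invertible B}"

definition translation :: "real ^ 'd \<Rightarrow> (real ^ 'd \<Rightarrow> complex) \<Rightarrow> real ^ 'd \<Rightarrow> complex" where
  "translation k f = (\<lambda>x. f (x - k))"

definition modulation :: "real ^ 'd \<Rightarrow> (real ^ 'd \<Rightarrow> complex) \<Rightarrow> real ^ 'd \<Rightarrow> complex" where
  "modulation l f = (\<lambda>x. exp (2 * pi * \<i> * (l \<bullet> x)) * f x)"

definition gabor_group :: "real ^ 'd ^ 'd \<Rightarrow> ((real ^ 'd) \<times> (real ^ 'd)) set" where
  "gabor_group B = int_vecs \<times> ((*v) B ` int_vecs)"

definition gabor_rep ::
  "(real ^ 'd) \<times> (real ^ 'd) \<Rightarrow> (real ^ 'd \<Rightarrow> complex) \<Rightarrow> real ^ 'd \<Rightarrow> complex" where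
  "gabor_rep = (\<lambda>(k, l) f. translation k (modulation l f))"

definition dual_lattice :: "real ^ 'd ^ 'd \<Rightarrow> ((real ^ 'd) \<times> (real ^ 'd)) set" where
  "dual_lattice B = int_vecs \<times> ((*v) (transpose (matrix_inv B)) ` int_vecs)"

definition character ::
  "(real ^ 'd) \<times> (real ^ 'd) \<Rightarrow> (real ^ 'd) \<times> (real ^ 'd) \<Rightarrow> complex" where
  "character = (\<lambda>(x, y) (k, l). exp (2 * pi * \<i> * (x \<bullet> k + y \<bullet> l)))"

(* The translates of \<Lambda> by \<Gamma> tile the space up to a null set; exact tilings are included. *)
definition fundamental_domain :: "'a::euclidean_space set \<Rightarrow> 'a set \<Rightarrow> bool" where
  "fundamental_domain \<Gamma> \<Lambda> \<longleftrightarrow>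
     \<Lambda> \<in> sets lebesgue \<and> (AE z in lebesgue. \<exists>!\<gamma>. \<gamma> \<in> \<Gamma> \<and> z - \<gamma> \<in> \<Lambda>)"

definition plancherel_measure ::
  "real ^ 'd ^ 'd \<Rightarrow> ((real ^ 'd) \<times> (real ^ 'd)) set \<Rightarrow> ((real ^ 'd) \<times> (real ^ 'd)) measure" where
  "plancherel_measure B \<Lambda> = scale_measure (ennreal \<bar>det B\<bar>) (lebesgue_on \<Lambda>)"

(* |det B| as a natural number; the floor is exact for integer matrices. *)
definition abs_det :: "real ^ 'd ^ 'd \<Rightarrow> nat" where
  "abs_det B = nat \<lfloor>\<bar>det B\<bar>\<rfloor>"

end

theory Submission
  imports Defs
begin

text \<open>Write \<open>a\<close> for the inverse transpose of \<open>B\<close> and \<open>N\<close> for the absolute value of its determinant. The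
  lattice \<open>a \<int>\<^sup>d\<close> contains \<open>\<int>\<^sup>d\<close> with index \<open>N\<close>, and \<open>B \<int>\<^sup>d\<close> is the lattice of frequencies that are
  trivial on it. Let \<open>D\<close> be the parallelepiped spanned by the columns of \<open>a\<close>, and let \<open>r\<^sub>i\<close>, for
  \<open>i < N\<close>, represent the cosets of \<open>\<int>\<^sup>d\<close>. The translates of \<open>D\<close> by \<open>a \<int>\<^sup>d\<close> tile the space, on each of
  them the exponentials with frequencies in \<open>B \<int>\<^sup>d\<close> are an orthogonal basis, and each of these
  translates is an integer translate of exactly one \<open>r\<^sub>i + D\<close>. So with \<open>f\<^sub>i\<close> the normalised indicator
  of \<open>r\<^sub>i + D\<close>, the vectors \<open>\<pi>(g) f\<^sub>i\<close>, for \<open>g\<close> in the Gabor group and \<open>i < N\<close>, are an orthonormal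
  basis of \<open>L\<^sup>2(\<real>\<^sup>d)\<close> (\<open>orthonormal_basis_gabor\<close>).

  On the other side, the characters of the group are an orthonormal basis of \<open>L\<^sup>2\<close> of any
  fundamental domain \<open>\<Lambda>\<close> with the Plancherel measure (\<open>orthonormal_basis_waves\<close>), so the characters
  times unit vectors are one of the direct integral. The unitary equivalence sends \<open>\<pi>(g) f\<^sub>i\<close> to
  the character \<open>g\<close> in component \<open>i\<close> (\<open>unitary_between_bases\<close>). It intertwines the representations
  because both of them translate the index \<open>g\<close>.

  If \<open>\<pi>(g) \<phi>\<close> were a Parseval frame, then the sum of \<open>|\<langle>f\<^sub>i, \<pi>(g) \<phi>\<rangle>|\<^sup>2\<close> over all \<open>g\<close> and \<open>i\<close> would be
  both \<open>N\<close> and the squared norm of \<open>\<phi>\<close>, while a member of a Parseval frame has norm at most 1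
  (\<open>no_parseval_generator\<close>). Here \<open>N \<ge> 2\<close>.

  The analytic core is that an integrable function on a fundamental domain with vanishing
  Fourier coefficients is zero (\<open>wave_complete\<close>). It is proved for arbitrary measurable fundamental
  domains at once, by a monotone class argument that starts from the exponentials. Integrals of
  periodic functions are the same over all fundamental domains, which yields the orthogonality of
  the exponentials (\<open>integral_wave\<close>) and, by comparing volumes, the index of \<open>\<int>\<^sup>d\<close> in \<open>a \<int>\<^sup>d\<close>
  (\<open>card_coset_reps\<close>).\<close>

section \<open>Square-integrable functions\<close>

abbreviation (input) ip :: "'a measure \<Rightarrow> ('a \<Rightarrow> complex) \<Rightarrow> ('a \<Rightarrow> complex) \<Rightarrow> complex" where
  "ip M \<equiv> hinner (L2 M)"

abbreviation (input) sq_int :: "'a measure \<Rightarrow> ('a \<Rightarrow> complex) set" where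
  "sq_int M \<equiv> hcarrier (L2 M)"

lemma sq_int_iff:
  "f \<in> sq_int M \<longleftrightarrow> f \<in> borel_measurable M \<and> integrable M (\<lambda>x. (cmod (f x))\<^sup>2)"
  by (auto simp: L2_def)

lemma sq_int_measurable: "f \<in> sq_int M \<Longrightarrow> f \<in> borel_measurable M"
  by (simp add: sq_int_iff)

lemma ip_eq: "ip M f g = (LINT x|M. f x * cnj (g x))"
  by (simp add: L2_def)

lemma borel_measurable_cnj [measurable (raw)]:
  "f \<in> borel_measurable M \<Longrightarrow> (\<lambda>x. cnj (f x)) \<in> borel_measurable M"
  by (rule measurable_compose[OF _ borel_measurable_continuous_onI]) (auto intro: continuous_intros)

lemma integrable_mult_cnj:
  assumes "f \<in> sq_int M" "g \<in> sq_int M"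
  shows "integrable M (\<lambda>x. f x * cnj (g x))"
proof (rule Bochner_Integration.integrable_bound)
  show "integrable M (\<lambda>x. (cmod (f x))\<^sup>2 + (cmod (g x))\<^sup>2)"
    using assms by (simp add: sq_int_iff)
  show "(\<lambda>x. f x * cnj (g x)) \<in> borel_measurable M"
    using assms[THEN sq_int_measurable] by measurable
  have "a * b \<le> a\<^sup>2 + b\<^sup>2" if "0 \<le> a" "0 \<le> b" for a b :: real
    using sum_squares_bound[of a b] mult_nonneg_nonneg[OF that] by linarith
  then show "AE x in M. norm (f x * cnj (g x)) \<le> norm ((cmod (f x))\<^sup>2 + (cmod (g x))\<^sup>2)"
    by (auto simp: norm_mult)
qed

lemma sq_int_add:
  assumes "f \<in> sq_int M" "g \<in> sq_int M"
  shows "(\<lambda>x. f x + g x) \<in> sq_int M"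
proof -
  have [measurable]: "f \<in> borel_measurable M" "g \<in> borel_measurable M"
    using assms by (auto simp: sq_int_iff)
  have "integrable M (\<lambda>x. (cmod (f x + g x))\<^sup>2)"
  proof (rule Bochner_Integration.integrable_bound)
    show "integrable M (\<lambda>x. 2 * (cmod (f x))\<^sup>2 + 2 * (cmod (g x))\<^sup>2)"
      using assms by (simp add: sq_int_iff)
    have "(cmod (a + b))\<^sup>2 \<le> 2 * (cmod a)\<^sup>2 + 2 * (cmod b)\<^sup>2" for a b
    proof -
      have "(cmod (a + b))\<^sup>2 \<le> (cmod a + cmod b)\<^sup>2"
        by (intro power_mono norm_triangle_ineq) auto
      also have "\<dots> \<le> 2 * (cmod a)\<^sup>2 + 2 * (cmod b)\<^sup>2"
        using sum_squares_bound[of "cmod a" "cmod b"] by (simp add: power2_sum)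
      finally show ?thesis .
    qed
    then show "AE x in M. norm ((cmod (f x + g x))\<^sup>2) \<le> norm (2 * (cmod (f x))\<^sup>2 + 2 * (cmod (g x))\<^sup>2)"
      by simp
  qed measurable
  then show ?thesis by (simp add: sq_int_iff)
qed

lemma sq_int_scale: "f \<in> sq_int M \<Longrightarrow> (\<lambda>x. c * f x) \<in> sq_int M"
  by (auto simp: sq_int_iff norm_mult power_mult_distrib)

lemma sq_int_0 [simp]: "(\<lambda>x. 0) \<in> sq_int M"
  by (simp add: sq_int_iff)

lemma sq_int_diff:
  "f \<in> sq_int M \<Longrightarrow> g \<in> sq_int M \<Longrightarrow> (\<lambda>x. f x - g x) \<in> sq_int M"
  using sq_int_add[of f M "\<lambda>x. -1 * g x"] sq_int_scale[of g M "-1"] by simp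

lemma sq_int_sum:
  "(\<And>j. j \<in> A \<Longrightarrow> f j \<in> sq_int M) \<Longrightarrow> (\<lambda>x. \<Sum>j\<in>A. f j x) \<in> sq_int M"
  by (induction A rule: infinite_finite_induct) (auto intro: sq_int_add)

lemma ip_add_left:
  "f \<in> sq_int M \<Longrightarrow> g \<in> sq_int M \<Longrightarrow> h \<in> sq_int M \<Longrightarrow>
    ip M (\<lambda>x. f x + g x) h = ip M f h + ip M g h"
  by (simp add: ip_eq distrib_right integrable_mult_cnj)

lemma ip_diff_left:
  "f \<in> sq_int M \<Longrightarrow> g \<in> sq_int M \<Longrightarrow> h \<in> sq_int M \<Longrightarrow>
    ip M (\<lambda>x. f x - g x) h = ip M f h - ip M g h"
  by (simp add: ip_eq left_diff_distrib integrable_mult_cnj)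

lemma ip_scale_left: "ip M (\<lambda>x. c * f x) h = c * ip M f h"
  by (simp add: ip_eq mult.assoc)

lemma ip_commute: "ip M g f = cnj (ip M f g)"
  unfolding ip_eq Bochner_Integration.integral_cnj[symmetric] complex_cnj_mult complex_cnj_cnj
  by (simp only: mult.commute)

lemma ip_sum_left:
  "(\<And>j. j \<in> A \<Longrightarrow> f j \<in> sq_int M) \<Longrightarrow> h \<in> sq_int M \<Longrightarrow>
    ip M (\<lambda>x. \<Sum>j\<in>A. f j x) h = (\<Sum>j\<in>A. ip M (f j) h)"
  by (simp add: ip_eq sum_distrib_right integrable_mult_cnj)

lemma ip_self: "ip M f f = complex_of_real (LINT x|M. (cmod (f x))\<^sup>2)"
  unfolding ip_eq complex_norm_square[symmetric] by (rule integral_complex_of_real)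

lemma hnorm_L2_sq: "(hnorm (L2 M) f)\<^sup>2 = (LINT x|M. (cmod (f x))\<^sup>2)"
  unfolding hnorm_def ip_self by simp

lemma hnorm_L2_nonneg [simp]: "0 \<le> hnorm (L2 M) f"
  unfolding hnorm_def ip_self by simp

lemma ip_self_hnorm: "ip M f f = complex_of_real ((hnorm (L2 M) f)\<^sup>2)"
  by (simp add: ip_self hnorm_L2_sq)

lemma ennreal_hnorm_L2_sq:
  "f \<in> sq_int M \<Longrightarrow> ennreal ((hnorm (L2 M) f)\<^sup>2) = (\<integral>\<^sup>+x. ennreal ((cmod (f x))\<^sup>2) \<partial>M)"
  by (simp add: hnorm_L2_sq sq_int_iff nn_integral_eq_integral)

lemma hnorm_L2_eq_0_iff:
  assumes "f \<in> sq_int M"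
  shows "hnorm (L2 M) f = 0 \<longleftrightarrow> (AE x in M. f x = 0)"
proof -
  have "hnorm (L2 M) f = 0 \<longleftrightarrow> (LINT x|M. (cmod (f x))\<^sup>2) = 0"
    unfolding hnorm_L2_sq[symmetric] by simp
  also have "\<dots> \<longleftrightarrow> (AE x in M. (cmod (f x))\<^sup>2 = 0)"
    using assms by (intro integral_nonneg_eq_0_iff_AE) (auto simp: sq_int_iff)
  finally show ?thesis by simp
qed

lemma hnorm_L2_add_sq:
  assumes "f \<in> sq_int M" "g \<in> sq_int M"
  shows "(hnorm (L2 M) (\<lambda>x. f x + g x))\<^sup>2
    = (hnorm (L2 M) f)\<^sup>2 + (hnorm (L2 M) g)\<^sup>2 + 2 * Re (ip M f g)"
proof -
  let ?h = "\<lambda>x. f x + g x"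
  have h: "?h \<in> sq_int M"
    using assms by (rule sq_int_add)
  have "ip M ?h ?h = ip M f ?h + ip M g ?h"
    by (rule ip_add_left[OF assms h])
  moreover have "ip M f ?h = cnj (ip M f f + ip M g f)"
    using ip_commute[of M f ?h] ip_add_left[OF assms assms(1)] by simp
  moreover have "ip M g ?h = cnj (ip M f g + ip M g g)"
    using ip_commute[of M g ?h] ip_add_left[OF assms assms(2)] by simp
  ultimately have "Re (ip M ?h ?h) = Re (ip M f f) + Re (ip M g f) + (Re (ip M f g) + Re (ip M g g))"
    by simp
  then show ?thesis
    unfolding ip_self_hnorm ip_commute[of M g f] by simp
qed

lemma Cauchy_Schwarz_L2:
  assumes "f \<in> sq_int M" "g \<in> sq_int M"
  shows "cmod (ip M f g) \<le> hnorm (L2 M) f * hnorm (L2 M) g"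
proof -
  have [measurable]: "f \<in> borel_measurable M" "g \<in> borel_measurable M"
    using assms by (auto simp: sq_int_iff)
  have "ennreal (cmod (ip M f g)) \<le> (\<integral>\<^sup>+x. ennreal (norm (f x * cnj (g x))) \<partial>M)"
    unfolding ip_eq using assms by (intro integral_norm_bound_ennreal integrable_mult_cnj)
  also have "\<dots> = (\<integral>\<^sup>+x. ennreal (cmod (f x)) * ennreal (cmod (g x)) \<partial>M)"
    by (simp add: norm_mult ennreal_mult)
  finally have "(ennreal (cmod (ip M f g)))\<^sup>2 \<le> (\<integral>\<^sup>+x. ennreal (cmod (f x)) * ennreal (cmod (g x)) \<partial>M)\<^sup>2"
    by (rule power_mono) simp
  also have "\<dots> \<le> (\<integral>\<^sup>+x. (ennreal (cmod (f x)))\<^sup>2 \<partial>M) * (\<integral>\<^sup>+x. (ennreal (cmod (g x)))\<^sup>2 \<partial>M)"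
    by (rule Cauchy_Schwarz_nn_integral) measurable
  also have "\<dots> = ennreal ((hnorm (L2 M) f * hnorm (L2 M) g)\<^sup>2)"
    using assms by (simp add: ennreal_power power_mult_distrib ennreal_mult ennreal_hnorm_L2_sq)
  finally have "(cmod (ip M f g))\<^sup>2 \<le> (hnorm (L2 M) f * hnorm (L2 M) g)\<^sup>2"
    by (simp add: ennreal_power)
  then show ?thesis
    by (rule power2_le_imp_le) simp
qed

text \<open>Monotone convergence applies to the squares weighted by \<open>2 ^ k\<close>: their integrals still decay
  geometrically.\<close>
lemma sq_int_fast_Cauchy_AE:
  fixes D :: "nat \<Rightarrow> 'a \<Rightarrow> complex"
  assumes D: "\<And>k. D k \<in> sq_int M" and bound: "\<And>k. (hnorm (L2 M) (D k))\<^sup>2 \<le> (1/4)^k"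
  shows "AE x in M. summable (\<lambda>k. D k x)"
proof -
  have [measurable]: "D k \<in> borel_measurable M" for k
    using D by (simp add: sq_int_iff)
  have "(\<integral>\<^sup>+x. (\<Sum>k. ennreal (2^k * (cmod (D k x))\<^sup>2)) \<partial>M)
      = (\<Sum>k. \<integral>\<^sup>+x. ennreal (2^k * (cmod (D k x))\<^sup>2) \<partial>M)"
    by (rule nn_integral_suminf) measurable
  also have "\<dots> = (\<Sum>k. ennreal (2^k * (hnorm (L2 M) (D k))\<^sup>2))"
    by (simp add: ennreal_mult nn_integral_cmult ennreal_hnorm_L2_sq[OF D])
  also have "\<dots> \<le> (\<Sum>k. ennreal ((1/2)^k))"
  proof (rule suminf_le)
    fix k
    have "2^k * (hnorm (L2 M) (D k))\<^sup>2 \<le> 2^k * (1/4)^k"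
      using bound by simp
    also have "\<dots> = (1/2::real)^k"
      by (simp flip: power_mult_distrib)
    finally show "ennreal (2^k * (hnorm (L2 M) (D k))\<^sup>2) \<le> ennreal ((1/2)^k)"
      by (rule ennreal_leI)
  qed simp_all
  also have "\<dots> = ennreal (\<Sum>k. (1/2)^k)"
    by (rule suminf_ennreal2) simp_all
  also have "\<dots> < \<infinity>" by simp
  finally have "AE x in M. (\<Sum>k. ennreal (2^k * (cmod (D k x))\<^sup>2)) \<noteq> \<infinity>"
    by (intro nn_integral_PInf_AE) (auto simp: less_top)
  then show ?thesis
  proof (eventually_elim)
    case (elim x)
    have s: "summable (\<lambda>k. 2^k * (cmod (D k x))\<^sup>2)"
      using elim by (intro summable_suminf_not_top) (auto simp: top_unique)
    \<comment> \<open>Splitting 1 = 2^(k/2) 2^(-k/2) and using ab <= a^2 + b^2 makes the series absolutely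
      convergent.\<close>
    have "cmod (D k x) \<le> 2^k * (cmod (D k x))\<^sup>2 + (1/2)^k" for k
    proof -
      define a where "a = (cmod (D k x))"
      have "0 \<le> (2^k * a - 1)\<^sup>2 + 2^k * a"
        by (simp add: a_def)
      then have "2^k * a \<le> 2^k * (2^k * a\<^sup>2 + (1/2)^k)"
        by (simp add: power2_diff algebra_simps power_mult_distrib power2_eq_square power_one_over)
      then show ?thesis unfolding a_def by (simp only: mult_le_cancel_left_pos zero_less_power zero_less_numeral)
    qed
    moreover have "summable (\<lambda>k. 2^k * (cmod (D k x))\<^sup>2 + (1/2)^k)"
      using s by (intro summable_add) simp_all
    ultimately show ?case
      by (intro summable_comparison_test[of "\<lambda>k. D k x"]) auto
  qed
qed

text \<open>Along a subsequence whose increments are geometrically small in norm the sequence converges almost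
  everywhere, and Fatou's lemma turns the pointwise limit into a limit in norm.\<close>
lemma L2_complete:
  fixes S :: "nat \<Rightarrow> 'a \<Rightarrow> complex"
  assumes S: "\<And>n. S n \<in> sq_int M"
    and Cauchy: "\<And>\<epsilon>. \<epsilon> > 0 \<Longrightarrow> \<exists>N. \<forall>m\<ge>N. \<forall>n\<ge>N. (hnorm (L2 M) (\<lambda>x. S m x - S n x))\<^sup>2 \<le> \<epsilon>"
  shows "\<exists>h\<in>sq_int M. (\<lambda>n. (hnorm (L2 M) (\<lambda>x. h x - S n x))\<^sup>2) \<longlonglongrightarrow> 0"
proof -
  have [measurable]: "S n \<in> borel_measurable M" for n
    using S by (simp add: sq_int_iff)
  obtain N where N: "\<And>k m n. m \<ge> N k \<Longrightarrow> n \<ge> N k \<Longrightarrow> (hnorm (L2 M) (\<lambda>x. S m x - S n x))\<^sup>2 \<le> (1/4)^k"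
    using Cauchy[of "(1/4)^k" for k] by (metis zero_less_power zero_less_divide_1_iff zero_less_numeral)
  define r where "r k = (\<Sum>j\<le>k. N j) + k" for k
  have N_le: "N k \<le> (\<Sum>j\<le>k. N j)" for k
    by (rule member_le_sum) auto
  have r_N: "r k \<ge> N k" "r (Suc k) \<ge> N k" "r k \<ge> k" for k
    using N_le[of k] by (auto simp: r_def)
  define D where "D k = (\<lambda>x. S (r (Suc k)) x - S (r k) x)" for k
  have "AE x in M. summable (\<lambda>k. D k x)"
    by (rule sq_int_fast_Cauchy_AE) (auto simp: D_def intro!: sq_int_diff S N r_N)
  then have conv: "AE x in M. convergent (\<lambda>k. S (r k) x)"
  proof eventually_elim
    case (elim x)
    have "(\<lambda>n. \<Sum>k<n. D k x) = (\<lambda>n. S (r n) x - S (r 0) x)"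
      unfolding D_def using sum_lessThan_telescope[of "\<lambda>n. S (r n) x"] by (intro ext)
    with elim have "convergent (\<lambda>n. S (r n) x - S (r 0) x)"
      by (simp add: summable_iff_convergent)
    from convergent_add[OF this convergent_const[of "S (r 0) x"]] show ?case by simp
  qed
  define h where "h x = lim (\<lambda>k. S (r k) x)" for x
  have [measurable]: "h \<in> borel_measurable M"
    unfolding h_def by measurable
  have lim: "AE x in M. (\<lambda>k. S (r k) x) \<longlonglongrightarrow> h x"
    using conv by eventually_elim (simp add: h_def convergent_LIMSEQ_iff)
  have Fatou: "(\<integral>\<^sup>+x. ennreal ((cmod (h x - S n x))\<^sup>2) \<partial>M) \<le> ennreal \<epsilon>"
    if "\<epsilon> > 0" and n: "\<And>m. m \<ge> n \<Longrightarrow> (hnorm (L2 M) (\<lambda>x. S m x - S n x))\<^sup>2 \<le> \<epsilon>" for n \<epsilon>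
  proof -
    have "(\<integral>\<^sup>+x. ennreal ((cmod (h x - S n x))\<^sup>2) \<partial>M)
        = (\<integral>\<^sup>+x. liminf (\<lambda>k. ennreal ((cmod (S (r k) x - S n x))\<^sup>2)) \<partial>M)"
    proof (rule nn_integral_cong_AE)
      show "AE x in M. ennreal ((cmod (h x - S n x))\<^sup>2) =
          liminf (\<lambda>k. ennreal ((cmod (S (r k) x - S n x))\<^sup>2))"
        using lim
      proof eventually_elim
        case (elim x)
        then have "(\<lambda>k. ennreal ((cmod (S (r k) x - S n x))\<^sup>2)) \<longlonglongrightarrow> ennreal ((cmod (h x - S n x))\<^sup>2)"
          by (intro tendsto_intros)
        then show ?case
          by (rule lim_imp_Liminf[OF sequentially_bot, symmetric])
      qed
    qed
    also have "\<dots> \<le> liminf (\<lambda>k. \<integral>\<^sup>+x. ennreal ((cmod (S (r k) x - S n x))\<^sup>2) \<partial>M)"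
      by (rule nn_integral_liminf) measurable
    also have "\<dots> \<le> limsup (\<lambda>k. \<integral>\<^sup>+x. ennreal ((cmod (S (r k) x - S n x))\<^sup>2) \<partial>M)"
      by (rule Liminf_le_Limsup) simp
    also have "\<dots> \<le> ennreal \<epsilon>"
    proof (rule Limsup_bounded)
      show "\<forall>\<^sub>F k in sequentially. (\<integral>\<^sup>+x. ennreal ((cmod (S (r k) x - S n x))\<^sup>2) \<partial>M) \<le> ennreal \<epsilon>"
        using eventually_ge_at_top[of n]
      proof eventually_elim
        case (elim k)
        then have "r k \<ge> n" using r_N(3)[of k] by simp
        from n[OF this] show ?case
          by (simp add: ennreal_hnorm_L2_sq[symmetric] sq_int_diff S ennreal_leI)
      qed
    qed
    finally show ?thesis .
  qed
  have diff: "(\<lambda>x. h x - S n x) \<in> sq_int M"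
    if "\<epsilon> > 0" "\<And>m. m \<ge> n \<Longrightarrow> (hnorm (L2 M) (\<lambda>x. S m x - S n x))\<^sup>2 \<le> \<epsilon>" for n \<epsilon>
  proof -
    have "(\<integral>\<^sup>+x. ennreal ((cmod (h x - S n x))\<^sup>2) \<partial>M) < \<infinity>"
      using Fatou[OF that] by (rule order_le_less_trans) simp_all
    then show ?thesis
      by (auto simp: sq_int_iff integrable_iff_bounded)
  qed
  have h: "h \<in> sq_int M"
    using sq_int_add[OF diff[of 1 "N 0"] S[of "N 0"]] N[of 0] by auto
  have "(\<lambda>n. (hnorm (L2 M) (\<lambda>x. h x - S n x))\<^sup>2) \<longlonglongrightarrow> 0"
  proof (rule LIMSEQ_I)
    fix e :: real assume "e > 0"
    then obtain N where N: "\<forall>m\<ge>N. \<forall>n\<ge>N. (hnorm (L2 M) (\<lambda>x. S m x - S n x))\<^sup>2 \<le> e/2"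
      using Cauchy[of "e/2"] by auto
    have "(hnorm (L2 M) (\<lambda>x. h x - S n x))\<^sup>2 \<le> e/2" if "n \<ge> N" for n
    proof -
      have "ennreal ((hnorm (L2 M) (\<lambda>x. h x - S n x))\<^sup>2) \<le> ennreal (e/2)"
        using N that \<open>e > 0\<close> by (subst ennreal_hnorm_L2_sq) (auto intro!: Fatou sq_int_diff h S)
      then show ?thesis using \<open>e > 0\<close> by (simp add: ennreal_le_iff)
    qed
    then show "\<exists>N. \<forall>n\<ge>N. norm ((hnorm (L2 M) (\<lambda>x. h x - S n x))\<^sup>2 - 0) < e"
      using \<open>e > 0\<close> by (intro exI[of _ N]) (force simp: field_simps)
  qed
  with h show ?thesis by blast
qed

section \<open>Orthonormal bases\<close>

definition orthonormal :: "'a measure \<Rightarrow> 'j set \<Rightarrow> ('j \<Rightarrow> 'a \<Rightarrow> complex) \<Rightarrow> bool" where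
  "orthonormal M J e \<longleftrightarrow> (\<forall>j\<in>J. e j \<in> sq_int M) \<and>
     (\<forall>i\<in>J. \<forall>j\<in>J. ip M (e i) (e j) = (if i = j then 1 else 0))"

definition orthonormal_basis :: "'a measure \<Rightarrow> 'j set \<Rightarrow> ('j \<Rightarrow> 'a \<Rightarrow> complex) \<Rightarrow> bool" where
  "orthonormal_basis M J e \<longleftrightarrow> countable J \<and> orthonormal M J e \<and>
     (\<forall>f\<in>sq_int M. (\<forall>j\<in>J. ip M f (e j) = 0) \<longrightarrow> (AE x in M. f x = 0))"

lemma ip_orthonormal_sum:
  assumes e: "orthonormal M J e" and A: "finite A" "A \<subseteq> J" and j: "j \<in> J"
  shows "ip M (\<lambda>x. \<Sum>i\<in>A. c i * e i x) (e j) = (if j \<in> A then c j else 0)"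
proof -
  have "ip M (\<lambda>x. \<Sum>i\<in>A. c i * e i x) (e j) = (\<Sum>i\<in>A. ip M (\<lambda>x. c i * e i x) (e j))"
    using assms by (intro ip_sum_left sq_int_scale) (auto simp: orthonormal_def)
  also have "\<dots> = (\<Sum>i\<in>A. if i = j then c i else 0)"
    using assms by (intro sum.cong) (auto simp: ip_scale_left orthonormal_def subset_iff)
  finally show ?thesis using A by simp
qed

lemma orthonormal_sum_sq_int:
  "orthonormal M J e \<Longrightarrow> A \<subseteq> J \<Longrightarrow> (\<lambda>x. \<Sum>i\<in>A. c i * e i x) \<in> sq_int M"
  by (intro sq_int_sum sq_int_scale) (auto simp: orthonormal_def)

text \<open>Pythagoras: the remainder is orthogonal to the partial sum that is subtracted. Bessel's inequality
  and the convergence of orthogonal series both come down to this identity.\<close>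
lemma hnorm_orthonormal_remainder:
  assumes e: "orthonormal M J e" and A: "finite A" "A \<subseteq> J" and f: "f \<in> sq_int M"
    and c: "\<And>j. j \<in> A \<Longrightarrow> ip M f (e j) = c j"
  shows "(hnorm (L2 M) (\<lambda>x. f x - (\<Sum>i\<in>A. c i * e i x)))\<^sup>2
    = (hnorm (L2 M) f)\<^sup>2 - (\<Sum>i\<in>A. (cmod (c i))\<^sup>2)"
proof -
  let ?s = "\<lambda>x. \<Sum>i\<in>A. c i * e i x"
  let ?d = "\<lambda>x. f x - ?s x"
  have s: "?s \<in> sq_int M" using e A(2) by (rule orthonormal_sum_sq_int)
  have d: "?d \<in> sq_int M" using f s by (rule sq_int_diff)
  have ej: "e j \<in> sq_int M" if "j \<in> A" for j using e A that by (auto simp: orthonormal_def)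
  have "ip M ?d (e j) = 0" if "j \<in> A" for j
    using that A ip_diff_left[OF f s ej] ip_orthonormal_sum[OF e A, of j c] c by auto
  then have 0: "ip M ?s ?d = 0"
    using ip_sum_left[of A "\<lambda>i x. c i * e i x" M ?d] d ej
    by (simp add: sq_int_scale ip_scale_left ip_commute[of M "e _" ?d])
  have "ip M ?s ?s = (\<Sum>i\<in>A. c i * ip M (e i) ?s)"
    using ip_sum_left[of A "\<lambda>i x. c i * e i x" M ?s] s ej by (simp add: sq_int_scale ip_scale_left)
  also have "\<dots> = (\<Sum>i\<in>A. c i * cnj (c i))"
    using A ip_orthonormal_sum[OF e A]
    by (intro sum.cong) (auto simp: ip_commute[of M "e _" ?s])
  finally have "ip M ?s ?s = complex_of_real (\<Sum>i\<in>A. (cmod (c i))\<^sup>2)"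
    by (simp only: of_real_sum complex_norm_square)
  then have "(hnorm (L2 M) ?s)\<^sup>2 = (\<Sum>i\<in>A. (cmod (c i))\<^sup>2)"
    unfolding ip_self_hnorm of_real_eq_iff .
  with hnorm_L2_add_sq[OF s d] 0 show ?thesis by simp
qed

lemma Bessel:
  assumes e: "orthonormal M J e" and f: "f \<in> sq_int M"
  shows "(\<lambda>j. (cmod (ip M f (e j)))\<^sup>2) summable_on J"
proof (rule nonneg_bdd_above_summable_on)
  show "bdd_above (sum (\<lambda>j. (cmod (ip M f (e j)))\<^sup>2) ` {F. F \<subseteq> J \<and> finite F})"
  proof (rule bdd_aboveI)
    fix s assume "s \<in> sum (\<lambda>j. (cmod (ip M f (e j)))\<^sup>2) ` {F. F \<subseteq> J \<and> finite F}"
    then obtain F where F: "F \<subseteq> J" "finite F" "s = sum (\<lambda>j. (cmod (ip M f (e j)))\<^sup>2) F" by auto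
    show "s \<le> (hnorm (L2 M) f)\<^sup>2"
      using hnorm_orthonormal_remainder[OF e F(2,1) f refl] F(3)
        zero_le_power2[of "hnorm (L2 M) (\<lambda>x. f x - (\<Sum>i\<in>F. ip M f (e i) * e i x))"] by linarith
  qed
qed simp

text \<open>By Pythagoras the partial sums along an enumeration of the index set form a Cauchy sequence. Their
  limit has the prescribed coefficients because inner products are continuous.\<close>
lemma orthonormal_synthesis:
  assumes e: "orthonormal M J e" and J: "countable J"
    and c: "(\<lambda>j. (cmod (c j))\<^sup>2) summable_on J"
  shows "\<exists>h\<in>sq_int M. (\<forall>j\<in>J. ip M h (e j) = c j) \<and>
    ((\<lambda>j. (cmod (c j))\<^sup>2) has_sum (hnorm (L2 M) h)\<^sup>2) J"
proof -
  define A where "A n = {j\<in>J. to_nat_on J j < n}" for n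
  have fin: "finite (A n)" for n
  proof (rule finite_imageD[of "to_nat_on J"])
    show "finite (to_nat_on J ` A n)"
      by (rule finite_subset[of _ "{..<n}"]) (auto simp: A_def)
    show "inj_on (to_nat_on J) (A n)"
      using inj_on_to_nat_on[OF J] by (rule inj_on_subset) (auto simp: A_def)
  qed
  have sub: "A n \<subseteq> J" "m \<le> n \<Longrightarrow> A m \<subseteq> A n" for m n
    by (auto simp: A_def)
  have lim_A: "filterlim A (finite_subsets_at_top J) sequentially"
    unfolding filterlim_finite_subsets_at_top
  proof (intro allI impI)
    fix X assume X: "finite X \<and> X \<subseteq> J"
    then obtain N where N: "\<forall>j\<in>X. to_nat_on J j < N"
      by (metis finite_nat_set_iff_bounded finite_imageI imageI)
    show "\<forall>\<^sub>F n in sequentially. finite (A n) \<and> X \<subseteq> A n \<and> A n \<subseteq> J"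
      using eventually_ge_at_top[of N] by eventually_elim (use N X fin sub in \<open>force simp: A_def\<close>)
  qed
  define S where "S n = (\<lambda>x. \<Sum>i\<in>A n. c i * e i x)" for n
  have S: "S n \<in> sq_int M" for n
    unfolding S_def using e sub(1) by (rule orthonormal_sum_sq_int)
  have S_e: "ip M (S n) (e j) = (if j \<in> A n then c j else 0)" if "j \<in> J" for n j
    unfolding S_def using e fin sub(1) that by (rule ip_orthonormal_sum)
  define s where "s n = (\<Sum>j\<in>A n. (cmod (c j))\<^sup>2)" for n
  have s_lim: "s \<longlonglongrightarrow> infsum (\<lambda>j. (cmod (c j))\<^sup>2) J"
    using filterlim_compose[OF infsum_tendsto[OF c] lim_A] unfolding s_def by simp
  have S_norm: "(hnorm (L2 M) (S n))\<^sup>2 = s n" for n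
  proof -
    have "ip M (S n) (e j) = c j" if "j \<in> A n" for j
      using S_e[of j n] that sub(1)[of n] by auto
    from hnorm_orthonormal_remainder[OF e fin[of n] sub(1) S this]
    show ?thesis by (simp add: S_def s_def hnorm_L2_sq)
  qed
  have S_diff: "(hnorm (L2 M) (\<lambda>x. S n x - S m x))\<^sup>2 = s n - s m" if "m \<le> n" for m n
  proof -
    have "ip M (S n) (e j) = c j" if "j \<in> A m" for j
    proof -
      have "j \<in> J" "j \<in> A n"
        using that sub(1) sub(2)[OF \<open>m \<le> n\<close>] by blast+
      then show ?thesis using S_e by simp
    qed
    from hnorm_orthonormal_remainder[OF e fin[of m] sub(1) S this] S_norm[of n]
    show ?thesis by (simp add: S_def[of m] s_def[of m])
  qed
  have S_sym: "(hnorm (L2 M) (\<lambda>x. S n x - S m x))\<^sup>2 = (hnorm (L2 M) (\<lambda>x. S m x - S n x))\<^sup>2" for m n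
    by (simp add: hnorm_L2_sq norm_minus_commute)
  have "\<exists>h\<in>sq_int M. (\<lambda>n. (hnorm (L2 M) (\<lambda>x. h x - S n x))\<^sup>2) \<longlonglongrightarrow> 0"
  proof (rule L2_complete[OF S])
    fix \<epsilon> :: real assume "\<epsilon> > 0"
    then obtain N where N: "\<And>m n. m \<ge> N \<Longrightarrow> n \<ge> N \<Longrightarrow> \<bar>s m - s n\<bar> < \<epsilon>"
      using LIMSEQ_imp_Cauchy[OF s_lim] unfolding Cauchy_def dist_real_def by metis
    have "(hnorm (L2 M) (\<lambda>x. S m x - S n x))\<^sup>2 \<le> \<epsilon>" if "m \<ge> N" "n \<ge> N" for m n
    proof (cases "n \<le> m")
      case True
      then show ?thesis using N[OF that] by (simp add: S_diff)
    next
      case False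
      then show ?thesis using N[OF that] by (simp add: S_sym[of m n] S_diff)
    qed
    then show "\<exists>N. \<forall>m\<ge>N. \<forall>n\<ge>N. (hnorm (L2 M) (\<lambda>x. S m x - S n x))\<^sup>2 \<le> \<epsilon>" by blast
  qed
  then obtain h where h: "h \<in> sq_int M" and lim: "(\<lambda>n. (hnorm (L2 M) (\<lambda>x. h x - S n x))\<^sup>2) \<longlonglongrightarrow> 0"
    by blast
  have he: "ip M h (e j) = c j" if j: "j \<in> J" for j
  proof -
    have ej: "e j \<in> sq_int M" using e j by (simp add: orthonormal_def)
    have "(\<lambda>n. hnorm (L2 M) (\<lambda>x. h x - S n x)) \<longlonglongrightarrow> 0"
      using tendsto_real_sqrt[OF lim] by simp
    then have "(\<lambda>n. hnorm (L2 M) (\<lambda>x. h x - S n x) * hnorm (L2 M) (e j)) \<longlonglongrightarrow> 0"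
      by (rule tendsto_mult_left_zero)
    then have "(\<lambda>n. ip M (\<lambda>x. h x - S n x) (e j)) \<longlonglongrightarrow> 0"
      by (rule Lim_null_comparison[rotated])
        (auto intro!: always_eventually Cauchy_Schwarz_L2 sq_int_diff h S ej)
    moreover have "\<forall>\<^sub>F n in sequentially. ip M (\<lambda>x. h x - S n x) (e j) = ip M h (e j) - c j"
      using eventually_gt_at_top[of "to_nat_on J j"]
      by eventually_elim (use j in \<open>simp add: ip_diff_left[OF h S ej] S_e A_def\<close>)
    ultimately have "(\<lambda>n. ip M h (e j) - c j) \<longlonglongrightarrow> 0"
      by (rule Lim_transform_eventually)
    then show ?thesis by (simp add: LIMSEQ_const_iff)
  qed
  have "(hnorm (L2 M) (\<lambda>x. h x - S n x))\<^sup>2 = (hnorm (L2 M) h)\<^sup>2 - s n" for n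
    unfolding S_def s_def using hnorm_orthonormal_remainder[OF e fin sub(1) h] he sub(1) by blast
  with lim have "(\<lambda>n. (hnorm (L2 M) h)\<^sup>2 - s n) \<longlonglongrightarrow> 0" by simp
  moreover have "(\<lambda>n. (hnorm (L2 M) h)\<^sup>2 - s n) \<longlonglongrightarrow> (hnorm (L2 M) h)\<^sup>2 - infsum (\<lambda>j. (cmod (c j))\<^sup>2) J"
    using s_lim by (intro tendsto_intros)
  ultimately have "(hnorm (L2 M) h)\<^sup>2 = infsum (\<lambda>j. (cmod (c j))\<^sup>2) J"
    using LIMSEQ_unique by fastforce
  then have "((\<lambda>j. (cmod (c j))\<^sup>2) has_sum (hnorm (L2 M) h)\<^sup>2) J"
    using c by simp
  with h he show ?thesis by blast
qed

text \<open>A function agrees almost everywhere with the one synthesised from its own coefficients, since their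
  difference is orthogonal to the whole basis.\<close>
lemma Parseval:
  assumes e: "orthonormal_basis M J e" and f: "f \<in> sq_int M"
  shows "((\<lambda>j. (cmod (ip M f (e j)))\<^sup>2) has_sum (hnorm (L2 M) f)\<^sup>2) J"
proof -
  have on: "orthonormal M J e" and J: "countable J"
    using e by (auto simp: orthonormal_basis_def)
  obtain h where h: "h \<in> sq_int M" "\<forall>j\<in>J. ip M h (e j) = ip M f (e j)"
    and sum: "((\<lambda>j. (cmod (ip M f (e j)))\<^sup>2) has_sum (hnorm (L2 M) h)\<^sup>2) J"
    using orthonormal_synthesis[OF on J Bessel[OF on f]] by blast
  have d: "(\<lambda>x. f x - h x) \<in> sq_int M"
    using f h(1) by (rule sq_int_diff)
  have "ip M (\<lambda>x. f x - h x) (e j) = 0" if "j \<in> J" for j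
    using ip_diff_left[OF f h(1)] h(2) on that by (simp add: orthonormal_def)
  with e d have "AE x in M. f x - h x = 0"
    unfolding orthonormal_basis_def by blast
  then have "(hnorm (L2 M) f)\<^sup>2 = (hnorm (L2 M) h)\<^sup>2"
    using f h unfolding hnorm_L2_sq by (intro integral_cong_AE) (auto dest!: sq_int_measurable)
  with sum show ?thesis by simp
qed

lemma orthonormal_basis_unique:
  assumes e: "orthonormal_basis M J e" and f: "f \<in> sq_int M" "g \<in> sq_int M"
    and eq: "\<And>j. j \<in> J \<Longrightarrow> ip M f (e j) = ip M g (e j)"
  shows "AE x in M. f x = g x"
proof -
  have "ip M (\<lambda>x. f x - g x) (e j) = 0" if "j \<in> J" for j
    using e that eq f by (simp add: orthonormal_basis_def orthonormal_def ip_diff_left)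
  then have "AE x in M. f x - g x = 0"
    using e sq_int_diff[OF f] unfolding orthonormal_basis_def by blast
  then show ?thesis by simp
qed

lemma orthonormal_basis_reindex:
  assumes e: "orthonormal_basis M J e" and b: "bij_betw b I J" and I: "countable I"
    and e': "\<And>i. i \<in> I \<Longrightarrow> e' i = e (b i)"
  shows "orthonormal_basis M I e'"
proof -
  have mem: "b i \<in> J" if "i \<in> I" for i using b that by (auto dest: bij_betwE)
  have inj: "b i = b j \<longleftrightarrow> i = j" if "i \<in> I" "j \<in> I" for i j
    using b that by (auto simp: bij_betw_def inj_on_def)
  have "orthonormal M I e'"
    using e mem inj e' by (auto simp: orthonormal_basis_def orthonormal_def)
  moreover have "\<forall>j\<in>J. ip M f (e j) = 0" if "\<forall>i\<in>I. ip M f (e' i) = 0" for f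
    using that b e' by (auto simp: bij_betw_def)
  ultimately show ?thesis using e I unfolding orthonormal_basis_def by blast
qed

section \<open>Fundamental domains\<close>

lemma emeasure_lebesgue_translation:
  "emeasure lebesgue ((+) t ` S) = emeasure lebesgue (S :: 'a::euclidean_space set)"
  using emeasure_lebesgue_affine[of 1 t S] by (simp add: add.commute cong: image_cong_simp)

lemma fundamental_domain_sets: "fundamental_domain \<Gamma> \<Lambda> \<Longrightarrow> \<Lambda> \<in> sets lebesgue"
  by (simp add: fundamental_domain_def)

lemma mem_translation_iff: "x \<in> (+) t ` S \<longleftrightarrow> x - t \<in> S" for x t :: "'a::ab_group_add"
  by (metis add_diff_cancel_left' diff_add_cancel add.commute image_iff)

text \<open>Almost every point lies in exactly one translate, so the indicators of the translates add up to 1.\<close>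
lemma emeasure_tiling:
  fixes \<Gamma> :: "'a::euclidean_space set"
  assumes \<Gamma>: "countable \<Gamma>" and \<Lambda>: "fundamental_domain \<Gamma> \<Lambda>" and S: "S \<in> sets lebesgue"
  shows "emeasure lebesgue S = (\<integral>\<^sup>+\<gamma>. emeasure lebesgue (S \<inter> (+) \<gamma> ` \<Lambda>) \<partial>count_space \<Gamma>)"
proof -
  have sets: "S \<inter> (+) \<gamma> ` \<Lambda> \<in> sets lebesgue" for \<gamma>
    using S lebesgue_sets_translation[OF fundamental_domain_sets[OF \<Lambda>]] by blast
  have "(\<integral>\<^sup>+\<gamma>. emeasure lebesgue (S \<inter> (+) \<gamma> ` \<Lambda>) \<partial>count_space \<Gamma>)
      = (\<integral>\<^sup>+\<gamma>. \<integral>\<^sup>+x. indicator (S \<inter> (+) \<gamma> ` \<Lambda>) x \<partial>lebesgue \<partial>count_space \<Gamma>)"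
    using sets by simp
  also have "\<dots> = (\<integral>\<^sup>+x. \<integral>\<^sup>+\<gamma>. indicator (S \<inter> (+) \<gamma> ` \<Lambda>) x \<partial>count_space \<Gamma> \<partial>lebesgue)"
    using \<Gamma> by (rule nn_integral_count_space_nn_integral[symmetric]) (use sets in simp)
  also have "\<dots> = (\<integral>\<^sup>+x. indicator S x \<partial>lebesgue)"
  proof (rule nn_integral_cong_AE)
    have "AE x in lebesgue. \<exists>!\<gamma>. \<gamma> \<in> \<Gamma> \<and> x - \<gamma> \<in> \<Lambda>"
      using \<Lambda> by (simp add: fundamental_domain_def)
    then show "AE x in lebesgue. (\<integral>\<^sup>+\<gamma>. indicator (S \<inter> (+) \<gamma> ` \<Lambda>) x \<partial>count_space \<Gamma>) = indicator S x"
    proof eventually_elim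
      case (elim x)
      then obtain \<gamma>0 where \<gamma>0: "\<gamma>0 \<in> \<Gamma>" "\<And>\<gamma>. \<gamma> \<in> \<Gamma> \<Longrightarrow> x - \<gamma> \<in> \<Lambda> \<longleftrightarrow> \<gamma> = \<gamma>0" by blast
      have "(\<integral>\<^sup>+\<gamma>. indicator (S \<inter> (+) \<gamma> ` \<Lambda>) x \<partial>count_space \<Gamma>)
          = (\<integral>\<^sup>+\<gamma>. indicator S x * indicator {\<gamma>0} \<gamma> \<partial>count_space \<Gamma>)"
        using \<gamma>0 by (intro nn_integral_cong) (auto simp: indicator_def mem_translation_iff)
      also have "\<dots> = indicator S x"
        using \<gamma>0(1) by (simp add: nn_integral_cmult)
      finally show ?case .
    qed
  qed
  also have "\<dots> = emeasure lebesgue S" using S by simp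
  finally show ?thesis by simp
qed

text \<open>Each of the two domains is cut by the translates of the other one, and translations in \<open>\<Gamma>\<close> match
  the resulting pieces.\<close>
lemma fundamental_domains_emeasure_eq:
  fixes \<Gamma> :: "'a::euclidean_space set"
  assumes \<Gamma>: "countable \<Gamma>" "\<And>\<gamma>. \<gamma> \<in> \<Gamma> \<Longrightarrow> -\<gamma> \<in> \<Gamma>"
    and \<Lambda>: "fundamental_domain \<Gamma> \<Lambda>" and \<Lambda>': "fundamental_domain \<Gamma> \<Lambda>'"
    and E: "E \<in> sets lebesgue" "\<And>\<gamma> z. \<gamma> \<in> \<Gamma> \<Longrightarrow> z - \<gamma> \<in> E \<longleftrightarrow> z \<in> E"
  shows "emeasure lebesgue (\<Lambda> \<inter> E) = emeasure lebesgue (\<Lambda>' \<inter> E)"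
proof -
  have "emeasure lebesgue (\<Lambda> \<inter> E)
      = (\<integral>\<^sup>+\<gamma>. emeasure lebesgue (\<Lambda> \<inter> E \<inter> (+) \<gamma> ` \<Lambda>') \<partial>count_space \<Gamma>)"
    using fundamental_domain_sets[OF \<Lambda>] E(1) by (intro emeasure_tiling \<Gamma> \<Lambda>') auto
  also have "\<dots> = (\<integral>\<^sup>+\<gamma>. emeasure lebesgue (\<Lambda> \<inter> E \<inter> (+) (-\<gamma>) ` \<Lambda>') \<partial>count_space \<Gamma>)"
    using \<Gamma>(2) by (intro nn_integral_bij_count_space[symmetric] bij_betwI[of _ _ _ uminus]) auto
  also have "\<dots> = (\<integral>\<^sup>+\<gamma>. emeasure lebesgue (\<Lambda>' \<inter> E \<inter> (+) \<gamma> ` \<Lambda>) \<partial>count_space \<Gamma>)"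
  proof (rule nn_integral_cong)
    fix \<gamma> assume "\<gamma> \<in> space (count_space \<Gamma>)"
    then have "\<Lambda>' \<inter> E \<inter> (+) \<gamma> ` \<Lambda> = (+) \<gamma> ` (\<Lambda> \<inter> E \<inter> (+) (-\<gamma>) ` \<Lambda>')"
      using E(2)[of \<gamma>] by (auto simp: mem_translation_iff set_eq_iff simp del: add_uminus_conv_diff)
    then show "emeasure lebesgue (\<Lambda> \<inter> E \<inter> (+) (-\<gamma>) ` \<Lambda>') = emeasure lebesgue (\<Lambda>' \<inter> E \<inter> (+) \<gamma> ` \<Lambda>)"
      by (simp only: emeasure_lebesgue_translation)
  qed
  also have "\<dots> = emeasure lebesgue (\<Lambda>' \<inter> E)"
    using fundamental_domain_sets[OF \<Lambda>'] E(1) by (intro emeasure_tiling[symmetric] \<Gamma> \<Lambda>) auto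
  finally show ?thesis .
qed

text \<open>Level sets of a periodic function are periodic, so the function has the same distribution on all
  fundamental domains.\<close>
lemma fundamental_domains_integral_eq:
  fixes \<Gamma> :: "'a::euclidean_space set" and g :: "'a \<Rightarrow> complex"
  assumes \<Gamma>: "countable \<Gamma>" "\<And>\<gamma>. \<gamma> \<in> \<Gamma> \<Longrightarrow> -\<gamma> \<in> \<Gamma>"
    and \<Lambda>: "fundamental_domain \<Gamma> \<Lambda>" and \<Lambda>': "fundamental_domain \<Gamma> \<Lambda>'"
    and g: "g \<in> borel_measurable lebesgue" "\<And>\<gamma> z. \<gamma> \<in> \<Gamma> \<Longrightarrow> g (z - \<gamma>) = g z"
  shows "(LINT x|lebesgue_on \<Lambda>. g x) = (LINT x|lebesgue_on \<Lambda>'. g x)"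
proof -
  have meas: "g \<in> borel_measurable (lebesgue_on S)" for S
    using g(1) by (rule measurable_restrict_space1)
  have dist: "emeasure (distr (lebesgue_on S) borel g) X = emeasure lebesgue (S \<inter> g -` X)"
    if "S \<in> sets lebesgue" "X \<in> sets borel" for S X
    using that measurable_sets[OF g(1) that(2)]
    by (simp add: emeasure_distr meas emeasure_restrict_space Int_commute)
  have "distr (lebesgue_on \<Lambda>) borel g = distr (lebesgue_on \<Lambda>') borel g"
  proof (rule measure_eqI)
    fix X assume "X \<in> sets (distr (lebesgue_on \<Lambda>) borel g)"
    then have X: "X \<in> sets borel" by simp
    have "emeasure lebesgue (\<Lambda> \<inter> g -` X) = emeasure lebesgue (\<Lambda>' \<inter> g -` X)"
      using measurable_sets[OF g(1) X] g(2)
      by (intro fundamental_domains_emeasure_eq[OF \<Gamma> \<Lambda> \<Lambda>']) auto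
    with X show "emeasure (distr (lebesgue_on \<Lambda>) borel g) X = emeasure (distr (lebesgue_on \<Lambda>') borel g) X"
      by (simp add: dist fundamental_domain_sets[OF \<Lambda>] fundamental_domain_sets[OF \<Lambda>'])
  qed simp
  moreover have "(LINT x|lebesgue_on S. g x) = (LINT y|distr (lebesgue_on S) borel g. y)" for S
    using meas by (subst integral_distr) auto
  ultimately show ?thesis by metis
qed

section \<open>Lattices and their characters\<close>

definition int_points :: "'a::euclidean_space set" where
  "int_points = {x. \<forall>b\<in>Basis. x \<bullet> b \<in> \<int>}"

lemma countable_int_points: "countable (int_points :: 'a::euclidean_space set)"
proof (rule countable_subset)
  show "(int_points :: 'a set) \<subseteq> (\<lambda>f. \<Sum>b\<in>Basis. f b *\<^sub>R b) ` (\<Pi>\<^sub>E b\<in>Basis. \<int>)"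
  proof
    fix x :: 'a assume x: "x \<in> int_points"
    have "x = (\<Sum>b\<in>Basis. restrict (\<lambda>b. x \<bullet> b) Basis b *\<^sub>R b)"
      by (simp add: euclidean_representation)
    with x show "x \<in> (\<lambda>f. \<Sum>b\<in>Basis. f b *\<^sub>R b) ` (\<Pi>\<^sub>E b\<in>Basis. \<int>)"
      by (intro image_eqI[of _ _ "restrict (\<lambda>b. x \<bullet> b) Basis"]) (auto simp: int_points_def)
  qed
  show "countable ((\<lambda>f. \<Sum>b\<in>Basis. f b *\<^sub>R (b::'a)) ` (\<Pi>\<^sub>E b\<in>Basis. \<int>))"
    by (intro countable_image countable_PiE) (auto simp: Ints_def)
qed

lemma int_points_add: "x \<in> int_points \<Longrightarrow> y \<in> int_points \<Longrightarrow> x + y \<in> int_points"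
  and int_points_minus: "x \<in> int_points \<Longrightarrow> - x \<in> int_points"
  and int_points_0: "0 \<in> int_points"
  and int_points_diff: "x \<in> int_points \<Longrightarrow> y \<in> int_points \<Longrightarrow> x - y \<in> int_points"
  by (auto simp: int_points_def inner_add_left inner_diff_left)

lemma int_points_inner: "x \<in> int_points \<Longrightarrow> y \<in> int_points \<Longrightarrow> x \<bullet> y \<in> \<int>"
  unfolding euclidean_inner[of x y] by (auto simp: int_points_def)

lemma int_points_Basis: "b \<in> Basis \<Longrightarrow> b \<in> int_points"
  by (auto simp: int_points_def inner_Basis)

definition wave :: "'a::euclidean_space \<Rightarrow> 'a \<Rightarrow> complex" where
  "wave l x = exp (2 * pi * \<i> * (l \<bullet> x))"

lemma wave_cis: "wave l x = cis (2 * pi * (l \<bullet> x))"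
  by (simp add: wave_def cis_conv_exp mult_ac)

lemma norm_wave [simp]: "cmod (wave l x) = 1"
  by (simp add: wave_cis)

lemma wave_add_left: "wave (l + l') x = wave l x * wave l' x"
  and wave_add_right: "wave l (x + y) = wave l x * wave l y"
  by (simp_all add: wave_cis inner_add_left inner_add_right distrib_left cis_mult)

lemma wave_minus_left: "wave (- l) x = cnj (wave l x)"
  and wave_minus_right: "wave l (- x) = cnj (wave l x)"
  by (simp_all add: wave_cis cis_cnj)

lemma wave_diff_left: "wave (l - l') x = wave l x * cnj (wave l' x)"
  using wave_add_left[of l "- l'" x] by (simp add: wave_minus_left)

lemma wave_diff_right: "wave l (x - y) = wave l x * cnj (wave l y)"
  using wave_add_right[of l x "- y"] by (simp add: wave_minus_right)

lemma wave_0 [simp]: "wave 0 x = 1" "wave l 0 = 1"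
  by (simp_all add: wave_cis)

lemma wave_eq_1: "l \<bullet> x \<in> \<int> \<Longrightarrow> wave l x = 1"
  unfolding wave_cis by (rule cis_multiple_2pi)

lemma wave_mult_cnj [simp]: "wave l x * cnj (wave l x) = 1"
  using complex_norm_square[of "wave l x"] by simp

lemma borel_measurable_wave: "wave l \<in> borel_measurable borel"
  unfolding wave_def by (intro borel_measurable_continuous_onI continuous_intros)

lemma lebesgue_measurable_wave: "wave l \<in> borel_measurable lebesgue"
  using borel_measurable_wave by (intro measurable_completion) simp

text \<open>A lattice is given by a linear map \<open>a\<close> together with its inverse transpose \<open>w\<close>; then
  \<open>z \<bullet> w b\<close> is the coordinate of \<open>z\<close> along the generator \<open>a b\<close>, and the frequencies in the image
  of \<open>w\<close> are the characters that are trivial on the lattice.\<close>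
locale lattice_pair =
  fixes a w :: "'a::euclidean_space \<Rightarrow> 'a"
  assumes lin_a: "linear a" and lin_w: "linear w" and dual: "a x \<bullet> w y = x \<bullet> y"
begin

lemma inj_a: "inj a"
proof (rule injI)
  fix x y assume "a x = a y"
  then have "(x - y) \<bullet> z = 0" for z
    using dual[of x z] dual[of y z] by (simp add: inner_diff_left)
  then show "x = y" by (metis inner_eq_zero_iff eq_iff_diff_eq_0)
qed

lemma surj_a: "surj a"
  using lin_a inj_a by (rule linear_inj_imp_surj)

lemma a_coordinates: "a (\<Sum>b\<in>Basis. (z \<bullet> w b) *\<^sub>R b) = z"
proof -
  obtain x where x: "z = a x" using surj_a by (metis surjD)
  show ?thesis unfolding x dual by (simp add: euclidean_representation)
qed

definition lat :: "'a set" where "lat = a ` int_points"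

definition dual_lat :: "'a set" where "dual_lat = w ` int_points"

lemma lat_iff: "z \<in> lat \<longleftrightarrow> (\<forall>b\<in>Basis. z \<bullet> w b \<in> \<int>)"
proof
  assume "\<forall>b\<in>Basis. z \<bullet> w b \<in> \<int>"
  then have "(\<Sum>b\<in>Basis. (z \<bullet> w b) *\<^sub>R b) \<in> int_points"
    by (simp add: int_points_def)
  then show "z \<in> lat" unfolding lat_def by (rule image_eqI[rotated]) (simp add: a_coordinates)
qed (auto simp: lat_def dual int_points_def)

lemma lat_inner_dual_lat: "\<gamma> \<in> lat \<Longrightarrow> \<omega> \<in> dual_lat \<Longrightarrow> \<omega> \<bullet> \<gamma> \<in> \<int>"
  by (auto simp: lat_def dual_lat_def dual inner_commute[of "w _"] int_points_inner)

lemma countable_lat: "countable lat" and countable_dual_lat: "countable dual_lat"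
  by (simp_all add: lat_def dual_lat_def countable_int_points)

lemma lat_0: "0 \<in> lat" and lat_minus: "\<gamma> \<in> lat \<Longrightarrow> - \<gamma> \<in> lat"
  and lat_add: "\<gamma> \<in> lat \<Longrightarrow> \<gamma>' \<in> lat \<Longrightarrow> \<gamma> + \<gamma>' \<in> lat"
  and lat_diff: "\<gamma> \<in> lat \<Longrightarrow> \<gamma>' \<in> lat \<Longrightarrow> \<gamma> - \<gamma>' \<in> lat"
  by (auto simp: lat_iff inner_add_left inner_diff_left)

lemma dual_lat_0: "0 \<in> dual_lat"
  and dual_lat_minus: "\<omega> \<in> dual_lat \<Longrightarrow> - \<omega> \<in> dual_lat"
  and dual_lat_add: "\<omega> \<in> dual_lat \<Longrightarrow> \<omega>' \<in> dual_lat \<Longrightarrow> \<omega> + \<omega>' \<in> dual_lat"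
  and dual_lat_diff: "\<omega> \<in> dual_lat \<Longrightarrow> \<omega>' \<in> dual_lat \<Longrightarrow> \<omega> - \<omega>' \<in> dual_lat"
proof -
  show "0 \<in> dual_lat" unfolding dual_lat_def
    by (rule image_eqI[of _ _ 0]) (auto simp: lin_w linear_0 int_points_0)
  show "- \<omega> \<in> dual_lat" if "\<omega> \<in> dual_lat" using that unfolding dual_lat_def
    by (auto simp: linear_neg[OF lin_w, symmetric] intro!: imageI int_points_minus)
  show "\<omega> + \<omega>' \<in> dual_lat" if "\<omega> \<in> dual_lat" "\<omega>' \<in> dual_lat" using that unfolding dual_lat_def
    by (auto simp: linear_add[OF lin_w, symmetric] intro!: imageI int_points_add)
  show "\<omega> - \<omega>' \<in> dual_lat" if "\<omega> \<in> dual_lat" "\<omega>' \<in> dual_lat" using that unfolding dual_lat_def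
    by (auto simp: linear_diff[OF lin_w, symmetric] intro!: imageI int_points_diff)
qed

lemma dual_lat_Basis: "b \<in> Basis \<Longrightarrow> w b \<in> dual_lat"
  by (simp add: dual_lat_def int_points_Basis)

lemma wave_periodic: "\<omega> \<in> dual_lat \<Longrightarrow> \<gamma> \<in> lat \<Longrightarrow> wave \<omega> (z - \<gamma>) = wave \<omega> z"
  by (simp add: wave_diff_right wave_eq_1 lat_inner_dual_lat)

text \<open>The half-open parallelepiped spanned by the generators of the lattice.\<close>
definition cell :: "'a set" where
  "cell = {z. \<forall>b\<in>Basis. 0 \<le> z \<bullet> w b \<and> z \<bullet> w b < 1}"

lemma cell_unique: "\<exists>!\<gamma>. \<gamma> \<in> lat \<and> z - \<gamma> \<in> cell"
proof (rule ex_ex1I)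
  define \<gamma> where "\<gamma> = a (\<Sum>b\<in>Basis. of_int \<lfloor>z \<bullet> w b\<rfloor> *\<^sub>R b)"
  have "\<gamma> \<bullet> w b = of_int \<lfloor>z \<bullet> w b\<rfloor>" if "b \<in> Basis" for b
    using that by (simp add: \<gamma>_def dual)
  then have "\<gamma> \<in> lat \<and> z - \<gamma> \<in> cell"
    by (auto simp: lat_iff cell_def inner_diff_left) linarith
  then show "\<exists>\<gamma>. \<gamma> \<in> lat \<and> z - \<gamma> \<in> cell" by blast
next
  fix \<gamma> \<gamma>' assume *: "\<gamma> \<in> lat \<and> z - \<gamma> \<in> cell" "\<gamma>' \<in> lat \<and> z - \<gamma>' \<in> cell"
  have "\<gamma> \<bullet> w b = \<gamma>' \<bullet> w b" if b: "b \<in> Basis" for b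
  proof -
    have "\<gamma> \<bullet> w b \<in> \<int>" "\<gamma>' \<bullet> w b \<in> \<int>"
      using * b by (auto simp: lat_iff)
    then obtain i j where "\<gamma> \<bullet> w b = of_int i" "\<gamma>' \<bullet> w b = of_int j" by (auto elim!: Ints_cases)
    then show ?thesis using * b by (force simp: cell_def inner_diff_left)
  qed
  then have "(\<Sum>b\<in>Basis. (\<gamma> \<bullet> w b) *\<^sub>R b) = (\<Sum>b\<in>Basis. (\<gamma>' \<bullet> w b) *\<^sub>R b)"
    by (intro sum.cong) simp_all
  then show "\<gamma> = \<gamma>'"
    by (metis a_coordinates)
qed

lemma borel_cell: "cell \<in> sets borel"
proof -
  have "cell = (\<Inter>b\<in>Basis. {z. 0 \<le> z \<bullet> w b} \<inter> {z. z \<bullet> w b < 1})"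
    by (auto simp: cell_def)
  also have "\<dots> \<in> sets borel"
    by (intro sets.finite_INT sets.Int borel_closed borel_open closed_Collect_le open_Collect_less
        continuous_intros) auto
  finally show ?thesis .
qed

lemma fundamental_domain_translated_cell: "fundamental_domain lat ((+) t ` cell)"
  unfolding fundamental_domain_def mem_translation_iff
proof
  show "(+) t ` cell \<in> sets lebesgue"
    using borel_cell by (intro lebesgue_sets_translation) simp
  have "\<exists>!\<gamma>. \<gamma> \<in> lat \<and> z - \<gamma> - t \<in> cell" for z
    using cell_unique[of "z - t"] by (simp add: algebra_simps)
  then show "AE z in lebesgue. \<exists>!\<gamma>. \<gamma> \<in> lat \<and> z - \<gamma> - t \<in> cell" by simp
qed

lemma fundamental_domain_cell: "fundamental_domain lat cell"
  using fundamental_domain_translated_cell[of 0] by simp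

lemma emeasure_fundamental_domain:
  assumes "fundamental_domain lat \<Lambda>"
  shows "emeasure lebesgue \<Lambda> = emeasure lebesgue cell"
  using fundamental_domains_emeasure_eq[OF countable_lat lat_minus assms fundamental_domain_cell, of UNIV]
  by simp

lemma cell_lmeasurable: "cell \<in> lmeasurable"
proof (rule bounded_set_imp_lmeasurable)
  have "cell \<subseteq> a ` cbox 0 One"
  proof
    fix z assume "z \<in> cell"
    then show "z \<in> a ` cbox 0 One"
      by (intro image_eqI[of _ _ "\<Sum>b\<in>Basis. (z \<bullet> w b) *\<^sub>R b"])
        (auto simp: a_coordinates mem_box cell_def intro: less_imp_le)
  qed
  moreover have "bounded (a ` cbox 0 One)"
    using lin_a by (intro bounded_linear_image bounded_cbox) (simp add: linear_conv_bounded_linear)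
  ultimately show "bounded cell" by (rule bounded_subset[rotated])
qed (use borel_cell in simp)

lemma fundamental_domain_lmeasurable:
  assumes "fundamental_domain lat \<Lambda>"
  shows "\<Lambda> \<in> lmeasurable"
  using assms cell_lmeasurable emeasure_fundamental_domain[OF assms]
  by (auto simp: fmeasurable_def fundamental_domain_def)

definition covolume :: real where "covolume = measure lebesgue cell"

lemma emeasure_cell: "emeasure lebesgue cell = ennreal covolume"
  using cell_lmeasurable by (simp add: covolume_def emeasure_eq_measure2)

lemma measure_fundamental_domain: "fundamental_domain lat \<Lambda> \<Longrightarrow> measure lebesgue \<Lambda> = covolume"
  using emeasure_fundamental_domain by (simp add: covolume_def measure_def)

text \<open>Countably many translates of the cell cover the whole space, which is not a null set.\<close>
lemma covolume_pos: "0 < covolume"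
proof (rule ccontr)
  assume "\<not> 0 < covolume"
  then have 0: "emeasure lebesgue cell = 0"
    by (simp add: emeasure_cell ennreal_neg)
  have "emeasure lebesgue (UNIV :: 'a set) = (\<integral>\<^sup>+\<gamma>. emeasure lebesgue (UNIV \<inter> (+) \<gamma> ` cell) \<partial>count_space lat)"
    by (rule emeasure_tiling[OF countable_lat fundamental_domain_cell]) simp
  then show False by (simp add: emeasure_lebesgue_translation 0)
qed

text \<open>A nontrivial character takes a value other than 1 at some t, while translating by t replaces
  one fundamental domain by another and so does not change the integral.\<close>
lemma integral_wave:
  assumes \<Lambda>: "fundamental_domain lat \<Lambda>" and \<omega>: "\<omega> \<in> dual_lat"
  shows "(LINT x|lebesgue_on \<Lambda>. wave \<omega> x) = (if \<omega> = 0 then complex_of_real covolume else 0)"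
proof (cases "\<omega> = 0")
  case True
  then show ?thesis
    using measure_fundamental_domain[OF \<Lambda>] fundamental_domain_sets[OF \<Lambda>]
    by (simp add: measure_restrict_space scaleR_conv_of_real)
next
  case False
  define t where "t = (1 / (2 * (\<omega> \<bullet> \<omega>))) *\<^sub>R \<omega>"
  have t: "wave \<omega> t = -1"
    using False by (simp add: t_def wave_cis)
  have eq: "(LINT x|lebesgue_on S. wave \<omega> x) = (LINT x|lborel. indicator S x *\<^sub>R wave \<omega> x)"
    if "S \<in> sets borel" for S
    using that borel_measurable_wave[of \<omega>]
    by (subst integral_restrict_space) (auto intro!: integral_completion)
  have tS: "(+) t ` cell \<in> sets borel"
  proof -
    have "(+) t ` cell = (\<lambda>x. x - t) -` cell \<inter> space borel" by (auto simp: mem_translation_iff)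
    also have "\<dots> \<in> sets borel" using borel_cell by (intro measurable_sets[of _ borel borel]) auto
    finally show ?thesis .
  qed
  let ?I = "LINT x|lebesgue_on cell. wave \<omega> x"
  have "?I = (LINT x|lebesgue_on ((+) t ` cell). wave \<omega> x)"
    by (intro fundamental_domains_integral_eq[of lat] countable_lat lat_minus fundamental_domain_cell
        fundamental_domain_translated_cell lebesgue_measurable_wave wave_periodic \<omega>)
  also have "\<dots> = (LINT x|distr lborel borel ((+) t). indicator ((+) t ` cell) x *\<^sub>R wave \<omega> x)"
    using eq[OF tS] by (simp add: lborel_distr_plus)
  also have "\<dots> = (LINT x|lborel. indicator ((+) t ` cell) (t + x) *\<^sub>R wave \<omega> (t + x))"
    using tS borel_measurable_wave[of \<omega>] by (intro integral_distr) auto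
  also have "\<dots> = (LINT x|lborel. - (indicator cell x *\<^sub>R wave \<omega> x))"
    by (intro Bochner_Integration.integral_cong)
      (auto simp: indicator_def mem_translation_iff wave_add_right t)
  also have "\<dots> = - ?I"
    using eq[OF borel_cell] by simp
  finally have "?I = 0" by simp
  moreover have "(LINT x|lebesgue_on \<Lambda>. wave \<omega> x) = ?I"
    by (intro fundamental_domains_integral_eq[of lat] countable_lat lat_minus fundamental_domain_cell
        \<Lambda> lebesgue_measurable_wave wave_periodic \<omega>)
  ultimately show ?thesis using False by simp
qed

end

section \<open>Uniqueness of Fourier coefficients\<close>

text \<open>To show that an integrable function \<open>F\<close> with vanishing Fourier coefficients is zero, one
  enlarges the set of functions against which it integrates to zero. The annihilated functions are
  the goal, but they are not closed under products. Their multipliers are: they form an algebra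
  that is closed under bounded pointwise limits and contains the characters. Hence the sets whose
  indicators are multipliers form a sigma-algebra.\<close>
definition annihilated :: "'a::euclidean_space measure \<Rightarrow> ('a \<Rightarrow> complex) \<Rightarrow> 'a set \<Rightarrow> ('a \<Rightarrow> complex) \<Rightarrow> bool" where
  "annihilated M F L u \<longleftrightarrow> u \<in> borel_measurable M \<and> bounded (range u) \<and>
     (\<forall>l\<in>L. (LINT x|M. F x * u x * wave l x) = 0)"

definition multiplier :: "'a::euclidean_space measure \<Rightarrow> ('a \<Rightarrow> complex) \<Rightarrow> 'a set \<Rightarrow> ('a \<Rightarrow> complex) \<Rightarrow> bool" where
  "multiplier M F L v \<longleftrightarrow> v \<in> borel_measurable M \<and> bounded (range v) \<and>
     (\<forall>u. annihilated M F L u \<longrightarrow> annihilated M F L (\<lambda>x. u x * v x))"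

lemma bounded_range_mult:
  fixes u v :: "'a \<Rightarrow> complex"
  assumes "bounded (range u)" "bounded (range v)"
  shows "bounded (range (\<lambda>x. u x * v x))"
proof -
  obtain C D where "\<And>x. cmod (u x) \<le> C" "\<And>x. cmod (v x) \<le> D"
    using assms unfolding bounded_iff by auto
  then have "cmod (u x * v x) \<le> C * D" for x
    unfolding norm_mult by (intro mult_mono) (auto intro: order_trans[OF norm_ge_zero])
  then show ?thesis unfolding bounded_iff by auto
qed

locale frequency_group =
  fixes M :: "'a::euclidean_space measure" and F :: "'a \<Rightarrow> complex" and L :: "'a set"
  assumes F: "integrable M F"
    and wave_measurable: "\<And>l. wave l \<in> borel_measurable M"
    and L_add: "\<And>l l'. l \<in> L \<Longrightarrow> l' \<in> L \<Longrightarrow> l + l' \<in> L"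
    and L_minus: "\<And>l. l \<in> L \<Longrightarrow> - l \<in> L"
begin

lemma integrable_bounded_mult:
  assumes u: "u \<in> borel_measurable M" "bounded (range u)"
  shows "integrable M (\<lambda>x. F x * u x * wave l x)"
proof -
  obtain C where C: "\<And>x. cmod (u x) \<le> C" using u(2) unfolding bounded_iff by auto
  have [measurable]: "wave l \<in> borel_measurable M" "F \<in> borel_measurable M" "u \<in> borel_measurable M"
    using wave_measurable F u by auto
  show ?thesis
  proof (rule Bochner_Integration.integrable_bound)
    show "integrable M (\<lambda>x. C * cmod (F x))" using F by auto
    show "AE x in M. norm (F x * u x * wave l x) \<le> norm (C * cmod (F x))"
      using C by (auto simp: norm_mult mult.commute[of C] abs_mult intro!: mult_left_mono order_trans[OF C abs_ge_self])
  qed measurable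
qed

lemma multiplier_const: "multiplier M F L (\<lambda>x. c)"
  unfolding multiplier_def annihilated_def
proof (intro conjI allI impI)
  fix u assume u: "u \<in> borel_measurable M \<and> bounded (range u) \<and> (\<forall>l\<in>L. (LINT x|M. F x * u x * wave l x) = 0)"
  then show "bounded (range (\<lambda>x. u x * c))"
    by (intro bounded_range_mult) (auto simp: bounded_iff)
  show "\<forall>l\<in>L. (LINT x|M. F x * (u x * c) * wave l x) = 0"
  proof
    fix l assume "l \<in> L"
    have "(LINT x|M. F x * (u x * c) * wave l x) = (LINT x|M. F x * u x * wave l x * c)"
      by (simp add: mult_ac)
    then show "(LINT x|M. F x * (u x * c) * wave l x) = 0"
      using u \<open>l \<in> L\<close> by (simp only: Bochner_Integration.integral_mult_left_zero) simp
  qed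
qed auto

lemma multiplier_add:
  assumes "multiplier M F L v" "multiplier M F L v'"
  shows "multiplier M F L (\<lambda>x. v x + v' x)"
proof -
  have bdd: "bounded (range (\<lambda>x. f x + g x))" if "bounded (range f)" "bounded (range g)" for f g :: "'a \<Rightarrow> complex"
    using bounded_plus_comp[OF that] by simp
  have "annihilated M F L (\<lambda>x. u x * (v x + v' x))" if u: "annihilated M F L u" for u
  proof -
    have uv: "annihilated M F L (\<lambda>x. u x * v x)" and uv': "annihilated M F L (\<lambda>x. u x * v' x)"
      using assms u by (auto simp: multiplier_def)
    have "(LINT x|M. F x * (u x * (v x + v' x)) * wave l x) = 0" if "l \<in> L" for l
    proof -
      have "(LINT x|M. F x * (u x * (v x + v' x)) * wave l x)
          = (LINT x|M. F x * (u x * v x) * wave l x + F x * (u x * v' x) * wave l x)"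
        by (simp add: algebra_simps)
      also have "\<dots> = 0"
        using uv uv' that by (subst Bochner_Integration.integral_add)
          (auto simp: annihilated_def intro!: integrable_bounded_mult)
      finally show ?thesis .
    qed
    moreover have "bounded (range (\<lambda>x. u x * (v x + v' x)))"
      using bdd[of "\<lambda>x. u x * v x" "\<lambda>x. u x * v' x"] uv uv' by (simp add: annihilated_def distrib_left)
    ultimately show ?thesis
      using u assms by (auto simp: annihilated_def multiplier_def)
  qed
  then show ?thesis
    using assms bdd by (auto simp: multiplier_def)
qed

lemma multiplier_mult:
  assumes "multiplier M F L v" "multiplier M F L v'"
  shows "multiplier M F L (\<lambda>x. v x * v' x)"
  unfolding multiplier_def mult.assoc[symmetric]
  using assms bounded_range_mult[of v v'] by (auto simp: multiplier_def)

lemma multiplier_scale: "multiplier M F L v \<Longrightarrow> multiplier M F L (\<lambda>x. c * v x)"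
  using multiplier_mult[OF multiplier_const] .

lemma multiplier_wave:
  assumes "l \<in> L"
  shows "multiplier M F L (wave l)"
proof -
  have bdd: "bounded (range (wave l))"
    by (auto simp: bounded_iff)
  have "annihilated M F L (\<lambda>x. u x * wave l x)" if u: "annihilated M F L u" for u
  proof -
    have "(LINT x|M. F x * (u x * wave l x) * wave l' x) = (LINT x|M. F x * u x * wave (l + l') x)" for l'
      by (simp add: wave_add_left mult_ac)
    then show ?thesis
      using u L_add[OF assms] wave_measurable[of l] bdd
      by (auto simp: annihilated_def intro!: bounded_range_mult)
  qed
  then show ?thesis
    using wave_measurable bdd by (auto simp: multiplier_def)
qed

lemma multiplier_cos: "l \<in> L \<Longrightarrow> multiplier M F L (\<lambda>x. complex_of_real (cos (2 * pi * (l \<bullet> x))))"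
proof -
  assume l: "l \<in> L"
  have eq: "complex_of_real (cos (2 * pi * (l \<bullet> x))) = (1/2) * (wave l x + wave (- l) x)" for x
    by (simp add: wave_cis complex_eq_iff)
  then show ?thesis
    using multiplier_scale[OF multiplier_add[OF multiplier_wave[OF l] multiplier_wave[OF L_minus[OF l]]], of "1/2"]
    by (simp only: eq)
qed

lemma multiplier_sin: "l \<in> L \<Longrightarrow> multiplier M F L (\<lambda>x. complex_of_real (sin (2 * pi * (l \<bullet> x))))"
proof -
  assume l: "l \<in> L"
  have eq: "complex_of_real (sin (2 * pi * (l \<bullet> x))) = (- \<i> / 2) * (wave l x + -1 * wave (- l) x)" for x
    by (simp add: wave_cis complex_eq_iff)
  then show ?thesis
    using multiplier_scale[OF multiplier_add[OF multiplier_wave[OF l] multiplier_scale[OF multiplier_wave[OF L_minus[OF l]], of "-1"]], of "- \<i> / 2"]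
    by (simp only: eq)
qed

lemma multiplier_limit:
  assumes v: "\<And>n. multiplier M F L (v n)" and C: "\<And>n x. cmod (v n x) \<le> C"
    and lim: "\<And>x. (\<lambda>n. v n x) \<longlonglongrightarrow> v' x"
  shows "multiplier M F L v'"
proof -
  have [measurable]: "v n \<in> borel_measurable M" for n
    using v by (auto simp: multiplier_def)
  have v'[measurable]: "v' \<in> borel_measurable M"
  proof (rule borel_measurable_LIMSEQ_metric)
    show "v n \<in> borel_measurable M" for n by measurable
    show "(\<lambda>n. v n x) \<longlonglongrightarrow> v' x" for x by (rule lim)
  qed
  have C': "cmod (v' x) \<le> C" for x
    using tendsto_norm[OF lim[of x]] by (rule LIMSEQ_le_const2) (use C in auto)
  then have bdd: "bounded (range v')"
    by (auto simp: bounded_iff)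
  have "annihilated M F L (\<lambda>x. u x * v' x)" if u: "annihilated M F L u" for u
  proof -
    have [measurable]: "u \<in> borel_measurable M" "F \<in> borel_measurable M"
      using u F by (auto simp: annihilated_def)
    obtain D where D: "\<And>x. cmod (u x) \<le> D" using u unfolding annihilated_def bounded_iff by auto
    have "(LINT x|M. F x * (u x * v' x) * wave l x) = 0" if l: "l \<in> L" for l
    proof -
      have [measurable]: "wave l \<in> borel_measurable M" by (rule wave_measurable)
      have "(\<lambda>n. LINT x|M. F x * (u x * v n x) * wave l x) \<longlonglongrightarrow> (LINT x|M. F x * (u x * v' x) * wave l x)"
      proof (rule integral_dominated_convergence)
        show "integrable M (\<lambda>x. D * C * cmod (F x))" using F by auto
        have "cmod (F x * (u x * v n x) * wave l x) \<le> D * C * cmod (F x)" for n x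
        proof -
          have "cmod (u x) * cmod (v n x) \<le> D * C"
            by (intro mult_mono D C) (auto intro: order_trans[OF norm_ge_zero D])
          then have "cmod (F x) * (cmod (u x) * cmod (v n x)) \<le> cmod (F x) * (D * C)"
            by (intro mult_left_mono) auto
          then show ?thesis by (simp add: norm_mult mult_ac)
        qed
        then show "AE x in M. norm (F x * (u x * v n x) * wave l x) \<le> D * C * cmod (F x)" for n
          by simp
        show "AE x in M. (\<lambda>n. F x * (u x * v n x) * wave l x) \<longlonglongrightarrow> F x * (u x * v' x) * wave l x"
          using lim by (intro AE_I2 tendsto_intros)
      qed measurable
      moreover have "(LINT x|M. F x * (u x * v n x) * wave l x) = 0" for n
        using v[of n] u l by (auto simp: multiplier_def annihilated_def)
      ultimately show ?thesis by (simp add: LIMSEQ_const_iff)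
    qed
    then show ?thesis
      using u bdd by (auto simp: annihilated_def intro: bounded_range_mult)
  qed
  then show ?thesis
    using bdd by (auto simp: multiplier_def)
qed

lemma multiplier_polynomial:
  fixes v :: "'a \<Rightarrow> real"
  assumes "real_polynomial_function p" and v: "multiplier M F L (\<lambda>x. complex_of_real (v x))"
  shows "multiplier M F L (\<lambda>x. complex_of_real (p (v x)))"
  using assms(1)
proof induction
  case (linear f)
  then obtain c where "f = (\<lambda>x. x * c)"
    using real_bounded_linear by blast
  then show ?case
    using multiplier_scale[OF v, of "complex_of_real c"] by (simp add: mult.commute)
next
  case (const c)
  show ?case by (rule multiplier_const)
next
  case (add f g)
  show ?case using multiplier_add[OF add.IH] by simp
next
  case (mult f g)
  show ?case using multiplier_mult[OF mult.IH] by simp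
qed

text \<open>Weierstrass approximation on \<open>[-1, 1]\<close>, where \<open>v\<close> takes its values.\<close>
lemma multiplier_continuous:
  fixes v :: "'a \<Rightarrow> real"
  assumes f: "continuous_on UNIV (f :: real \<Rightarrow> real)" and v: "multiplier M F L (\<lambda>x. complex_of_real (v x))"
    and v1: "\<And>x. \<bar>v x\<bar> \<le> 1"
  shows "multiplier M F L (\<lambda>x. complex_of_real (f (v x)))"
proof -
  have f': "continuous_on {-1..1} f" using f continuous_on_subset by blast
  have "\<exists>p. real_polynomial_function p \<and> (\<forall>t\<in>{-1..1}. \<bar>f t - p t\<bar> < inverse (real (Suc n)))" for n
  proof -
    have "0 < inverse (real (Suc n))" by simp
    from Stone_Weierstrass_real_polynomial_function[OF compact_Icc f' this] show ?thesis by metis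
  qed
  then obtain p where p: "\<And>n. real_polynomial_function (p n)"
    "\<And>n t. t \<in> {-1..1} \<Longrightarrow> \<bar>f t - p n t\<bar> < inverse (real (Suc n))" by metis
  have v1': "v x \<in> {-1..1}" for x using v1[of x] by auto
  obtain C where C: "\<And>t. t \<in> {-1..1} \<Longrightarrow> \<bar>f t\<bar> \<le> C"
    using compact_imp_bounded[OF compact_continuous_image[OF f' compact_Icc]]
    unfolding bounded_iff by (force simp: Ball_def)
  show ?thesis
  proof (rule multiplier_limit)
    show "multiplier M F L (\<lambda>x. complex_of_real (p n (v x)))" for n
      using p(1) v by (rule multiplier_polynomial)
    show "cmod (complex_of_real (p n (v x))) \<le> C + 1" for n x
    proof -
      have "inverse (real (Suc n)) \<le> 1"
        by (rule inverse_le_1_iff[THEN iffD2]) simp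
      then show ?thesis
        using p(2)[OF v1'[of x], of n] C[OF v1'[of x]] unfolding norm_of_real by linarith
    qed
    show "(\<lambda>n. complex_of_real (p n (v x))) \<longlonglongrightarrow> complex_of_real (f (v x))" for x
    proof (rule tendsto_of_real)
      have "(\<lambda>n. f (v x) - p n (v x)) \<longlonglongrightarrow> 0"
        by (rule Lim_null_comparison[OF _ LIMSEQ_inverse_real_of_nat])
          (use p(2)[OF v1'[of x]] in \<open>auto intro!: always_eventually less_imp_le\<close>)
      from tendsto_diff[OF tendsto_const[of "f (v x)"] this]
      show "(\<lambda>n. p n (v x)) \<longlonglongrightarrow> f (v x)" by simp
    qed
  qed
qed

text \<open>The indicator of an open half-line is a bounded pointwise limit of continuous functions.\<close>
lemma multiplier_superlevel:
  fixes v :: "'a \<Rightarrow> real"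
  assumes v: "multiplier M F L (\<lambda>x. complex_of_real (v x))" and v1: "\<And>x. \<bar>v x\<bar> \<le> 1"
  shows "multiplier M F L (indicator {x. c < v x})"
proof (rule multiplier_limit)
  define f where "f n t = min 1 (max 0 (real n * (t - c)))" for n t
  show "multiplier M F L (\<lambda>x. complex_of_real (f n (v x)))" for n
    unfolding f_def using v v1
    by (intro multiplier_continuous[where f = "\<lambda>t. min 1 (max 0 (real n * (t - c)))"] continuous_intros)
  show "cmod (complex_of_real (f n (v x))) \<le> 1" for n x
    by (simp add: f_def)
  show "(\<lambda>n. complex_of_real (f n (v x))) \<longlonglongrightarrow> indicator {x. c < v x} x" for x
  proof (cases "c < v x")
    case True
    obtain n0 where n0: "1 / (v x - c) < real n0" using reals_Archimedean2 by blast
    have "\<forall>\<^sub>F n in sequentially. complex_of_real (f n (v x)) = 1"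
      using eventually_ge_at_top[of n0]
    proof eventually_elim
      case (elim n)
      then have "1 / (v x - c) \<le> real n" using n0 by simp
      then have "1 \<le> real n * (v x - c)" using True by (simp add: field_simps)
      then show ?case by (simp add: f_def)
    qed
    then show ?thesis using True by (simp add: tendsto_eventually)
  next
    case False
    then have "real n * (v x - c) \<le> 0" for n by (simp add: mult_nonneg_nonpos)
    then have "f n (v x) = 0" for n by (simp add: f_def max_absorb1)
    then show ?thesis using False by simp
  qed
qed

lemma sigma_algebra_multiplier: "sigma_algebra UNIV {E. multiplier M F L (indicator E)}"
  unfolding sigma_algebra_iff2
proof (intro conjI ballI allI impI)
  show "{} \<in> {E. multiplier M F L (indicator E)}"
    using multiplier_const[of 0] by (simp add: indicator_def[abs_def])
  have compl: "multiplier M F L (indicator (- E))" if "multiplier M F L (indicator E)" for E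
  proof -
    have "(indicator (- E) :: 'a \<Rightarrow> complex) = (\<lambda>x. 1 + -1 * indicator E x)"
      by (auto simp: indicator_def)
    then show ?thesis
      using multiplier_add[OF multiplier_const[of 1] multiplier_scale[OF that, of "-1"]] by simp
  qed
  then show "UNIV - E \<in> {E. multiplier M F L (indicator E)}"
    if "E \<in> {E. multiplier M F L (indicator E)}" for E
    using that by (simp add: Compl_eq_Diff_UNIV)
  have un: "multiplier M F L (indicator (E \<union> E'))"
    if "multiplier M F L (indicator E)" "multiplier M F L (indicator E')" for E E'
  proof -
    have "(indicator (E \<union> E') :: 'a \<Rightarrow> complex) = (\<lambda>x. indicator E x + indicator (- E) x * indicator E' x)"
      by (auto simp: indicator_def)
    then show ?thesis
      using multiplier_add[OF that(1) multiplier_mult[OF compl[OF that(1)] that(2)]] by simp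
  qed
  fix A :: "nat \<Rightarrow> 'a set"
  assume "range A \<subseteq> {E. multiplier M F L (indicator E)}"
  then have A: "multiplier M F L (indicator (A i))" for i by auto
  have "multiplier M F L (indicator (\<Union>i<n. A i))" for n
  proof (induction n)
    case 0
    show ?case using multiplier_const[of 0] by (simp add: indicator_def[abs_def])
  next
    case (Suc n)
    then show ?case using un[OF A[of n]] by (simp add: lessThan_Suc)
  qed
  then have "multiplier M F L (indicator (\<Union>i. A i))"
    by (rule multiplier_limit[where v = "\<lambda>n. indicator (\<Union>i<n. A i)" and C = 1])
      (rule LIMSEQ_indicator_UN | simp add: indicator_def)+
  then show "(\<Union>i. A i) \<in> {E. multiplier M F L (indicator E)}" by simp
qed simp

definition multiplier_sets :: "'a measure" where
  "multiplier_sets = sigma UNIV {E. multiplier M F L (indicator E)}"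

lemma sets_multiplier_sets: "sets multiplier_sets = {E. multiplier M F L (indicator E)}"
  unfolding multiplier_sets_def
  using sigma_algebra.sets_measure_of_eq[OF sigma_algebra_multiplier] by simp

lemma space_multiplier_sets: "space multiplier_sets = UNIV"
  unfolding multiplier_sets_def by (rule space_measure_of) simp

text \<open>The fractional part is recovered from cosine and sine as a Borel function: the sine tells the
  two halves of the circle apart.\<close>
lemma measurable_frac:
  assumes l: "l \<in> L"
  shows "(\<lambda>x. frac (l \<bullet> x)) \<in> borel_measurable multiplier_sets"
proof -
  have c: "(\<lambda>x. cos (2 * pi * (l \<bullet> x))) \<in> borel_measurable multiplier_sets"
    by (rule borel_measurableI_greater)
      (auto simp: space_multiplier_sets sets_multiplier_sets intro!: multiplier_superlevel multiplier_cos l)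
  have s: "(\<lambda>x. sin (2 * pi * (l \<bullet> x))) \<in> borel_measurable multiplier_sets"
    by (rule borel_measurableI_greater)
      (auto simp: space_multiplier_sets sets_multiplier_sets intro!: multiplier_superlevel multiplier_sin l)
  define A where "A t = arccos (max (-1) (min 1 t))" for t
  have A: "A \<in> borel_measurable borel"
    unfolding A_def by (intro borel_measurable_continuous_onI continuous_intros) auto
  have frac: "frac t = (if sin (2 * pi * t) \<ge> 0 then A (cos (2 * pi * t)) else 2 * pi - A (cos (2 * pi * t))) / (2 * pi)" for t
  proof -
    define r where "r = frac t"
    have r: "0 \<le> r" "r < 1" by (auto simp: r_def frac_lt_1)
    have "2 * pi * t = 2 * pi * r + 2 * pi * of_int \<lfloor>t\<rfloor>"
      by (simp add: r_def frac_def algebra_simps)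
    then have cs: "cos (2 * pi * t) = cos (2 * pi * r)" "sin (2 * pi * t) = sin (2 * pi * r)"
      by (simp_all add: cos_add sin_add)
    have A_cos: "A (cos y) = arccos (cos y)" for y
      by (simp add: A_def min_absorb2 max_absorb2)
    show ?thesis
    proof (cases "r \<le> 1/2")
      case True
      then have "sin (2 * pi * r) \<ge> 0" "arccos (cos (2 * pi * r)) = 2 * pi * r"
        using r by (auto intro!: sin_ge_zero arccos_cos)
      then show ?thesis by (simp add: cs A_cos flip: r_def)
    next
      case False
      have "sin (2 * pi * r) = - sin (2 * pi * (1 - r))" "cos (2 * pi * r) = cos (2 * pi * (1 - r))"
        by (simp_all add: right_diff_distrib sin_diff cos_diff)
      moreover have "sin (2 * pi * (1 - r)) > 0"
        using r False by (intro sin_gt_zero) auto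
      moreover have "arccos (cos (2 * pi * (1 - r))) = 2 * pi * (1 - r)"
        using r False by (intro arccos_cos) auto
      ultimately have "\<not> 0 \<le> sin (2 * pi * t)" "A (cos (2 * pi * t)) = 2 * pi * (1 - r)"
        by (simp_all only: cs A_cos)
      then show ?thesis by (simp add: field_simps flip: r_def)
    qed
  qed
  note [measurable] = measurable_compose[OF c A] s
  show ?thesis unfolding frac by measurable
qed

end

context lattice_pair begin

text \<open>The representative modulo the lattice that lies in the cell.\<close>
definition reduce :: "'a \<Rightarrow> 'a" where
  "reduce x = a (\<Sum>b\<in>Basis. frac (x \<bullet> w b) *\<^sub>R b)"

lemma reduce_diff: "reduce x - x \<in> lat"
proof -
  have "reduce x \<bullet> w b - x \<bullet> w b \<in> \<int>" if "b \<in> Basis" for b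
    using that by (simp add: reduce_def dual frac_def)
  then show ?thesis by (simp add: lat_iff inner_diff_left)
qed

text \<open>Fractional parts of lattice coordinates are measurable with respect to the sigma-algebra of
  multiplier sets, hence so is the reduction modulo the lattice, and every periodic Borel set is a
  multiplier set. A Borel subset of a fundamental domain is, up to a null set, the part of a
  periodic set inside it. So the function has integral zero over every such subset.\<close>
lemma wave_complete:
  assumes \<Lambda>: "fundamental_domain lat \<Lambda>" and F: "integrable (lebesgue_on \<Lambda>) F"
    and 0: "\<And>\<omega>. \<omega> \<in> dual_lat \<Longrightarrow> (LINT x|lebesgue_on \<Lambda>. F x * wave \<omega> x) = 0"
  shows "AE x in lebesgue_on \<Lambda>. F x = 0"
proof -
  let ?M = "lebesgue_on \<Lambda>"
  have \<Lambda>_sets: "\<Lambda> \<in> sets lebesgue" using \<Lambda> by (rule fundamental_domain_sets)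
  interpret finite_measure ?M
    using \<Lambda> by (intro finite_measure_lebesgue_on fundamental_domain_lmeasurable)
  interpret frequency_group ?M F dual_lat
    by unfold_locales
      (fact F dual_lat_add dual_lat_minus measurable_restrict_space1[OF lebesgue_measurable_wave])+
  have reduce: "reduce \<in> borel_measurable multiplier_sets"
  proof -
    have "(\<lambda>x. \<Sum>b\<in>Basis. frac (w b \<bullet> x) *\<^sub>R (b::'a)) \<in> borel_measurable multiplier_sets"
      by (intro borel_measurable_sum borel_measurable_scaleR measurable_frac dual_lat_Basis) auto
    moreover have "a \<in> borel_measurable borel"
      using lin_a by (intro borel_measurable_continuous_onI linear_continuous_on) (simp add: linear_conv_bounded_linear)
    ultimately show ?thesis
      unfolding reduce_def inner_commute[of _ "w _"] by (rule measurable_compose)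
  qed
  have borel_case: "set_lebesgue_integral ?M S F = 0" if S: "S \<in> sets borel" "S \<subseteq> \<Lambda>" for S
  proof -
    \<comment> \<open>The periodic extension of S is its own preimage under the reduction map.\<close>
    define E where "E = (\<Union>\<gamma>\<in>lat. (+) \<gamma> ` S)"
    have E_mem: "x \<in> E \<longleftrightarrow> (\<exists>\<gamma>\<in>lat. x - \<gamma> \<in> S)" for x
      by (simp add: E_def mem_translation_iff)
    have "(+) \<gamma> ` S \<in> sets borel" for \<gamma>
    proof -
      have "(+) \<gamma> ` S = (\<lambda>x. x - \<gamma>) -` S \<inter> space borel" by (auto simp: mem_translation_iff)
      also have "\<dots> \<in> sets borel" using S by (intro measurable_sets[of _ borel borel]) auto
      finally show ?thesis .
    qed
    then have "E \<in> sets borel"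
      unfolding E_def by (intro sets.countable_UN'[OF countable_lat]) auto
    then have "reduce -` E \<inter> space multiplier_sets \<in> sets multiplier_sets"
      by (rule measurable_sets[OF reduce])
    moreover have "reduce -` E = E"
    proof -
      have "reduce x \<in> E \<longleftrightarrow> x \<in> E" for x
      proof
        assume "reduce x \<in> E"
        then obtain \<gamma> where "\<gamma> \<in> lat" "reduce x - \<gamma> \<in> S" by (auto simp: E_mem)
        then show "x \<in> E"
          using lat_diff[of \<gamma> "reduce x - x"] reduce_diff[of x]
          by (auto simp: E_mem intro!: bexI[of _ "\<gamma> - (reduce x - x)"])
      next
        assume "x \<in> E"
        then obtain \<gamma> where "\<gamma> \<in> lat" "x - \<gamma> \<in> S" by (auto simp: E_mem)
        then show "reduce x \<in> E"
          using lat_add[of \<gamma> "reduce x - x"] reduce_diff[of x]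
          by (auto simp: E_mem intro!: bexI[of _ "\<gamma> + (reduce x - x)"])
      qed
      then show ?thesis by auto
    qed
    ultimately have "multiplier ?M F dual_lat (indicator E)"
      by (simp add: space_multiplier_sets sets_multiplier_sets)
    moreover have "annihilated ?M F dual_lat (\<lambda>x. 1)"
      using 0 by (auto simp: annihilated_def bounded_iff)
    ultimately have ann: "annihilated ?M F dual_lat (\<lambda>x. 1 * indicator E x)"
      unfolding multiplier_def by blast
    then have E0: "(LINT x|?M. F x * indicator E x) = 0"
      using dual_lat_0 unfolding annihilated_def by force
    have "AE x in lebesgue. \<exists>!\<gamma>. \<gamma> \<in> lat \<and> x - \<gamma> \<in> \<Lambda>"
      using \<Lambda> by (simp add: fundamental_domain_def)
    then have "AE x in lebesgue. x \<in> \<Lambda> \<longrightarrow> indicator S x *\<^sub>R F x = F x * indicator E x"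
    proof eventually_elim
      case (elim x)
      have "x \<in> S" if "x \<in> \<Lambda>" "x \<in> E"
      proof -
        from \<open>x \<in> E\<close> obtain \<gamma> where \<gamma>: "\<gamma> \<in> lat" "x - \<gamma> \<in> S" by (auto simp: E_mem)
        moreover have "0 \<in> lat \<and> x - 0 \<in> \<Lambda>" "\<gamma> \<in> lat \<and> x - \<gamma> \<in> \<Lambda>"
          using that lat_0 \<gamma> S(2) by auto
        ultimately have "\<gamma> = 0" using elim by blast
        with \<gamma> show ?thesis by simp
      qed
      moreover have "x \<in> E" if "x \<in> S"
        using that lat_0 by (auto simp: E_mem intro!: bexI[of _ 0])
      ultimately show ?case by (auto simp: indicator_def)
    qed
    then have AE: "AE x in ?M. indicator S x *\<^sub>R F x = F x * indicator E x"
      using \<Lambda>_sets by (simp add: AE_restrict_space_iff)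
    have S': "S \<in> sets ?M" using S \<Lambda>_sets by (simp add: sets_restrict_space_iff)
    have E': "(\<lambda>x. F x * indicator E x) \<in> borel_measurable ?M"
      using ann F unfolding annihilated_def by auto
    show ?thesis
      unfolding set_lebesgue_integral_def E0[symmetric]
      by (rule integral_cong_AE) (use S' E' F AE in auto)
  qed
  show ?thesis
  proof (rule density_zero[OF F])
    fix S assume "S \<in> sets ?M"
    then have S: "S \<in> sets lebesgue" "S \<subseteq> \<Lambda>"
      using \<Lambda>_sets by (auto simp: sets_restrict_space_iff)
    obtain T N N' where T: "S = T \<union> N" "N \<subseteq> N'" "N' \<in> null_sets lborel" "T \<in> sets lborel"
      using sets_completionE[OF S(1)] by blast
    have T': "T \<in> sets borel" "T \<subseteq> \<Lambda>" using T S(2) by auto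
    have "AE x in lebesgue. x \<notin> N'"
      using T(3) by (intro AE_completion AE_not_in)
    then have "AE x in lebesgue. x \<in> \<Lambda> \<longrightarrow> indicator S x *\<^sub>R F x = indicator T x *\<^sub>R F x"
      by eventually_elim (use T in \<open>auto simp: indicator_def\<close>)
    then have AE: "AE x in ?M. indicator S x *\<^sub>R F x = indicator T x *\<^sub>R F x"
      using \<Lambda>_sets by (simp add: AE_restrict_space_iff)
    have "S \<in> sets ?M" "T \<in> sets ?M"
      using S T' \<Lambda>_sets by (auto simp: sets_restrict_space_iff)
    then have "set_lebesgue_integral ?M S F = set_lebesgue_integral ?M T F"
      unfolding set_lebesgue_integral_def using F AE by (intro integral_cong_AE) auto
    also have "\<dots> = 0" using T' by (rule borel_case)
    finally show "set_lebesgue_integral ?M S F = 0" .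
  qed
qed

end

section \<open>Bases of exponentials\<close>

lemma scale_measure_density:
  "scale_measure r M = density M (\<lambda>_. r)"
  by (rule measure_eqI) (simp_all add: emeasure_density_const)

lemma integral_scale_measure:
  fixes f :: "'a \<Rightarrow> 'b::{banach, second_countable_topology}"
  assumes "0 \<le> c" "f \<in> borel_measurable M"
  shows "(LINT x|scale_measure (ennreal c) M. f x) = c *\<^sub>R (LINT x|M. f x)"
  using assms by (simp add: scale_measure_density integral_density)

lemma integrable_scale_measure:
  fixes f :: "'a \<Rightarrow> 'b::{banach, second_countable_topology}"
  assumes "0 < c" "f \<in> borel_measurable M"
  shows "integrable (scale_measure (ennreal c) M) f \<longleftrightarrow> integrable M f"
proof -
  have "integrable M f" if "integrable M (\<lambda>x. c *\<^sub>R f x)"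
    using integrable_scaleR_right[of "1 / c", OF that] assms(1) by simp
  then have "integrable M (\<lambda>x. c *\<^sub>R f x) \<longleftrightarrow> integrable M f" by auto
  with assms show ?thesis by (simp add: scale_measure_density integrable_density)
qed

lemma AE_scale_measure:
  assumes "0 < c"
  shows "(AE x in scale_measure (ennreal c) M. P x) \<longleftrightarrow> (AE x in M. P x)"
  unfolding scale_measure_density using assms by (subst AE_density) auto

context lattice_pair begin

lemma sq_int_integrable:
  assumes "fundamental_domain lat \<Lambda>" "f \<in> sq_int (lebesgue_on \<Lambda>)"
  shows "integrable (lebesgue_on \<Lambda>) f"
proof -
  have "(\<lambda>x. 1) \<in> sq_int (lebesgue_on \<Lambda>)"
    using fundamental_domain_lmeasurable[OF assms(1)]
    by (simp add: sq_int_iff finite_measure.integrable_const finite_measure_lebesgue_on)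
  from integrable_mult_cnj[OF assms(2) this] show ?thesis by simp
qed

lemma coefficients_zero:
  assumes \<Lambda>: "fundamental_domain lat \<Lambda>" and f: "f \<in> sq_int (lebesgue_on \<Lambda>)"
    and 0: "\<And>\<omega>. \<omega> \<in> dual_lat \<Longrightarrow> ip (lebesgue_on \<Lambda>) f (wave \<omega>) = 0"
  shows "AE x in lebesgue_on \<Lambda>. f x = 0"
proof (rule wave_complete[OF \<Lambda> sq_int_integrable[OF \<Lambda> f]])
  fix \<omega> assume "\<omega> \<in> dual_lat"
  then show "(LINT x|lebesgue_on \<Lambda>. f x * wave \<omega> x) = 0"
    using 0[OF dual_lat_minus[of \<omega>]] by (simp add: ip_eq wave_minus_left)
qed

lemma ip_waves:
  assumes "fundamental_domain lat \<Lambda>" "\<omega> \<in> dual_lat" "\<omega>' \<in> dual_lat"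
  shows "ip (lebesgue_on \<Lambda>) (wave \<omega>) (wave \<omega>') = (if \<omega> = \<omega>' then complex_of_real covolume else 0)"
  using integral_wave[OF assms(1) dual_lat_diff[OF assms(2,3)]] by (simp add: ip_eq wave_diff_left)

lemma wave_sq_int:
  assumes "fundamental_domain lat \<Lambda>"
  shows "wave \<omega> \<in> sq_int (lebesgue_on \<Lambda>)"
  using fundamental_domain_lmeasurable[OF assms] lebesgue_measurable_wave
  by (auto simp: sq_int_iff finite_measure.integrable_const finite_measure_lebesgue_on
      intro!: measurable_restrict_space1)

lemma orthonormal_basis_waves:
  assumes \<Lambda>: "fundamental_domain lat \<Lambda>"
  shows "orthonormal_basis (scale_measure (ennreal (1 / covolume)) (lebesgue_on \<Lambda>)) dual_lat wave"
    (is "orthonormal_basis ?\<mu> _ _")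
proof -
  have c: "0 < 1 / covolume" using covolume_pos by simp
  have sq_int: "f \<in> sq_int ?\<mu> \<longleftrightarrow> f \<in> sq_int (lebesgue_on \<Lambda>)" for f
  proof -
    have "integrable ?\<mu> (\<lambda>x. (cmod (f x))\<^sup>2) \<longleftrightarrow> integrable (lebesgue_on \<Lambda>) (\<lambda>x. (cmod (f x))\<^sup>2)"
      if "f \<in> borel_measurable (lebesgue_on \<Lambda>)"
      using that by (intro integrable_scale_measure[OF c]) measurable
    then show ?thesis
      unfolding sq_int_iff measurable_cong_sets[OF sets_scale_measure refl] by blast
  qed
  have ip_scale: "ip ?\<mu> f g = (1 / covolume) *\<^sub>R ip (lebesgue_on \<Lambda>) f g"
    if "f \<in> sq_int (lebesgue_on \<Lambda>)" "g \<in> sq_int (lebesgue_on \<Lambda>)" for f g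
    unfolding ip_eq using c integrable_mult_cnj[OF that] by (intro integral_scale_measure) auto
  have "orthonormal ?\<mu> dual_lat wave"
    unfolding orthonormal_def using covolume_pos
    by (auto simp: sq_int ip_scale wave_sq_int[OF \<Lambda>] ip_waves[OF \<Lambda>] scaleR_conv_of_real)
  moreover have "AE x in ?\<mu>. f x = 0" if f: "f \<in> sq_int ?\<mu>" and 0: "\<And>\<omega>. \<omega> \<in> dual_lat \<Longrightarrow> ip ?\<mu> f (wave \<omega>) = 0" for f
    unfolding AE_scale_measure[OF c]
  proof (rule coefficients_zero[OF \<Lambda>])
    show f': "f \<in> sq_int (lebesgue_on \<Lambda>)" using f sq_int by simp
    show "ip (lebesgue_on \<Lambda>) f (wave \<omega>) = 0" if "\<omega> \<in> dual_lat" for \<omega>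
      using 0[OF that] ip_scale[OF f' wave_sq_int[OF \<Lambda>]] covolume_pos by simp
  qed
  ultimately show ?thesis
    unfolding orthonormal_basis_def using countable_dual_lat by blast
qed

definition wave_packet :: "'a \<times> 'a \<Rightarrow> 'a \<Rightarrow> complex" where
  "wave_packet = (\<lambda>(\<gamma>, \<omega>) x. complex_of_real (1 / sqrt covolume) * (indicator cell (x - \<gamma>) * wave \<omega> x))"

lemma ip_restrict:
  assumes S: "S \<in> sets lebesgue"
  shows "(LINT x|lebesgue. f x * (indicator S x * g x)) = (LINT x|lebesgue_on S. f x * (g x :: complex))"
  using S by (subst integral_restrict_space)
    (auto simp: indicator_def scaleR_conv_of_real intro!: Bochner_Integration.integral_cong)

lemma sq_int_restrict:
  assumes S: "S \<in> sets lebesgue" and f: "f \<in> sq_int lebesgue"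
  shows "f \<in> sq_int (lebesgue_on S)"
  using S f integrable_real_mult_indicator[of S lebesgue "\<lambda>x. (cmod (f x))\<^sup>2"]
  by (auto simp: sq_int_iff integrable_restrict_space measurable_restrict_space1 mult.commute)

lemma wave_packet_sq_int: "wave_packet (\<gamma>, \<omega>) \<in> sq_int lebesgue"
proof -
  have S: "(+) \<gamma> ` cell \<in> lmeasurable"
    using fundamental_domain_lmeasurable[OF fundamental_domain_translated_cell] .
  have i: "indicator cell (x - \<gamma>) = indicator ((+) \<gamma> ` cell) x" for x
    by (simp add: indicator_def mem_translation_iff)
  have "integrable lebesgue (\<lambda>x. indicat_real ((+) \<gamma> ` cell) x * (1 / covolume))"
    using S by (intro integrable_mult_left integrable_real_indicator) (auto simp: fmeasurable_def)
  moreover have "(cmod (wave_packet (\<gamma>, \<omega>) x))\<^sup>2 = indicat_real ((+) \<gamma> ` cell) x * (1 / covolume)" for x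
    using covolume_pos
    by (auto simp: wave_packet_def norm_mult indicator_def power_divide norm_divide mem_translation_iff)
  moreover have "wave_packet (\<gamma>, \<omega>) \<in> borel_measurable lebesgue"
  proof -
    have "(\<lambda>x. complex_of_real (1 / sqrt covolume) * (indicator ((+) \<gamma> ` cell) x * wave \<omega> x))
        \<in> borel_measurable lebesgue"
      using S by (intro borel_measurable_times borel_measurable_const borel_measurable_indicator
          lebesgue_measurable_wave) (simp add: fmeasurableD)
    then show ?thesis by (simp only: wave_packet_def prod.case i)
  qed
  ultimately show ?thesis by (simp add: sq_int_iff)
qed

lemma ip_wave_packet:
  "ip lebesgue f (wave_packet (\<gamma>, \<omega>)) = complex_of_real (1 / sqrt covolume) * ip (lebesgue_on ((+) \<gamma> ` cell)) f (wave \<omega>)"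
proof -
  have i: "indicator cell (x - \<gamma>) = indicator ((+) \<gamma> ` cell) x" for x
    by (simp add: indicator_def mem_translation_iff)
  have S: "(+) \<gamma> ` cell \<in> sets lebesgue"
    using fundamental_domain_sets[OF fundamental_domain_translated_cell] .
  have "ip lebesgue f (wave_packet (\<gamma>, \<omega>))
    = (LINT x|lebesgue. complex_of_real (1 / sqrt covolume) * (f x * (indicator ((+) \<gamma> ` cell) x * cnj (wave \<omega> x))))"
    unfolding ip_eq wave_packet_def i
    by (intro Bochner_Integration.integral_cong) (auto simp: indicator_def mem_translation_iff)
  also have "\<dots> = complex_of_real (1 / sqrt covolume) * (LINT x|lebesgue_on ((+) \<gamma> ` cell). f x * cnj (wave \<omega> x))"
    unfolding ip_restrict[OF S, symmetric] by simp
  finally show ?thesis by (simp add: ip_eq)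
qed

text \<open>The translates of the cell tile the space, and on each of them the characters are an orthogonal
  basis.\<close>
lemma orthonormal_basis_wave_packets:
  "orthonormal_basis lebesgue (lat \<times> dual_lat) wave_packet"
proof -
  have "ip lebesgue (wave_packet (\<gamma>', \<omega>')) (wave_packet (\<gamma>, \<omega>)) = (if (\<gamma>', \<omega>') = (\<gamma>, \<omega>) then 1 else 0)"
    if \<gamma>: "\<gamma> \<in> lat" "\<gamma>' \<in> lat" and \<omega>: "\<omega> \<in> dual_lat" "\<omega>' \<in> dual_lat" for \<gamma> \<gamma>' \<omega> \<omega>'
  proof -
    let ?S = "(+) \<gamma> ` cell"
    define k where "k = complex_of_real (1 / sqrt covolume)"
    have fd: "fundamental_domain lat ?S" by (rule fundamental_domain_translated_cell)
    have "ip (lebesgue_on ?S) (wave_packet (\<gamma>', \<omega>')) (wave \<omega>)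
        = ip (lebesgue_on ?S) (\<lambda>x. of_bool (\<gamma> = \<gamma>') * complex_of_real (1 / sqrt covolume) * wave \<omega>' x) (wave \<omega>)"
      unfolding ip_eq
    proof (rule Bochner_Integration.integral_cong[OF refl])
      fix x assume "x \<in> space (lebesgue_on ?S)"
      then have "x - \<gamma> \<in> cell" by (simp add: mem_translation_iff)
      then have "x - \<gamma>' \<in> cell \<longleftrightarrow> \<gamma> = \<gamma>'" using cell_unique[of x] \<gamma> by blast
      then show "wave_packet (\<gamma>', \<omega>') x * cnj (wave \<omega> x)
          = of_bool (\<gamma> = \<gamma>') * complex_of_real (1 / sqrt covolume) * wave \<omega>' x * cnj (wave \<omega> x)"
        by (simp add: wave_packet_def indicator_def)
    qed
    also have "\<dots> = of_bool (\<gamma> = \<gamma>') * complex_of_real (1 / sqrt covolume) * (if \<omega>' = \<omega> then complex_of_real covolume else 0)"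
      unfolding ip_scale_left ip_waves[OF fd \<omega>(2,1)] ..
    finally have "ip lebesgue (wave_packet (\<gamma>', \<omega>')) (wave_packet (\<gamma>, \<omega>))
        = k * (of_bool (\<gamma> = \<gamma>') * k * (if \<omega>' = \<omega> then complex_of_real covolume else 0))"
      unfolding ip_wave_packet k_def by simp
    moreover have "k * k * complex_of_real covolume = 1"
      unfolding k_def of_real_mult[symmetric] using covolume_pos by simp
    ultimately show ?thesis by (auto simp: mult.assoc)
  qed
  then have "orthonormal lebesgue (lat \<times> dual_lat) wave_packet"
    unfolding orthonormal_def using wave_packet_sq_int by auto
  moreover have "AE x in lebesgue. f x = 0"
    if f: "f \<in> sq_int lebesgue" and 0: "\<And>j. j \<in> lat \<times> dual_lat \<Longrightarrow> ip lebesgue f (wave_packet j) = 0" for f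
  proof -
    have "AE x in lebesgue. x - \<gamma> \<in> cell \<longrightarrow> f x = 0" if \<gamma>: "\<gamma> \<in> lat" for \<gamma>
    proof -
      let ?S = "(+) \<gamma> ` cell"
      have fd: "fundamental_domain lat ?S" by (rule fundamental_domain_translated_cell)
      have S: "?S \<in> sets lebesgue" by (rule fundamental_domain_sets[OF fd])
      have "AE x in lebesgue_on ?S. f x = 0"
      proof (rule coefficients_zero[OF fd sq_int_restrict[OF S f]])
        fix \<omega> assume "\<omega> \<in> dual_lat"
        then show "ip (lebesgue_on ?S) f (wave \<omega>) = 0"
          using 0[of "(\<gamma>, \<omega>)"] \<gamma> covolume_pos by (simp add: ip_wave_packet)
      qed
      then show ?thesis using S by (simp add: AE_restrict_space_iff mem_translation_iff)
    qed
    then have "AE x in lebesgue. \<forall>\<gamma>\<in>lat. x - \<gamma> \<in> cell \<longrightarrow> f x = 0"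
      unfolding AE_ball_countable[OF countable_lat] by blast
    then show ?thesis
      by eventually_elim (use cell_unique in blast)
  qed
  ultimately show ?thesis
    unfolding orthonormal_basis_def using countable_lat countable_dual_lat by blast
qed

end

section \<open>Covolume and index\<close>

lemma linear_image_translation:
  assumes "linear f"
  shows "f ` (+) t ` S = (+) (f t) ` f ` S"
  using linear_add[OF assms] by (auto simp: image_image)

text \<open>Linear maps are generated by singular, diagonal, transposition and shear maps. The determinants of
  the last two are found by permuting rows and by a row operation, which is meaningful for an
  index type without an order.\<close>
lemma measure_linear_image_det:
  fixes f :: "real^'n \<Rightarrow> real^'n"
  assumes f: "linear f" and S: "S \<in> lmeasurable"
  shows "measure lebesgue (f ` S) = \<bar>det (matrix f)\<bar> * measure lebesgue S"
proof -
  let ?P = "\<lambda>f :: real^'n \<Rightarrow> real^'n. \<forall>S\<in>lmeasurable. f ` S \<in> lmeasurable \<and>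
    measure lebesgue (f ` S) = \<bar>det (matrix f)\<bar> * measure lebesgue S"
  have det1: "?P h" if lin: "linear h" and det: "\<bar>det (matrix h)\<bar> = 1"
    and box: "\<And>a b. cbox a b \<noteq> {} \<Longrightarrow> measure lebesgue (h ` cbox a b) = measure lebesgue (cbox a b)" for h
  proof
    fix S :: "(real^'n) set" assume S: "S \<in> lmeasurable"
    have "measure lebesgue (h ` cbox a b) = 1 * measure lebesgue (cbox a b)" for a b
      using box[of a b] by (cases "cbox a b = {}") auto
    from measure_linear_sufficient[OF lin S this] det
    show "h ` S \<in> lmeasurable \<and> measure lebesgue (h ` S) = \<bar>det (matrix h)\<bar> * measure lebesgue S" by simp
  qed
  have "?P f" using f
  proof (rule induct_linear_elementary)
    fix f g :: "real^'n \<Rightarrow> real^'n"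
    assume "linear f" "linear g" "?P f" "?P g"
    then show "?P (f \<circ> g)"
      unfolding image_comp[symmetric] matrix_compose[OF \<open>linear g\<close> \<open>linear f\<close>] det_mul abs_mult by simp
  next
    fix f :: "real^'n \<Rightarrow> real^'n" and i
    assume lin: "linear f" and 0: "\<And>x. f x $ i = 0"
    have "\<not> surj f"
      using 0 by (metis surjD axis_nth zero_neq_one)
    then have ninj: "\<not> inj f" using lin linear_injective_imp_surjective by blast
    then have "negligible (f ` S)" for S
      using negligible_linear_singular_image[OF lin] by blast
    then show "?P f"
      using ninj det_nz_iff_inj[OF lin] negligible_iff_measure by fastforce
  next
    fix c :: "'n \<Rightarrow> real"
    have "det (matrix (\<lambda>x. \<chi> i. c i * x $ i)) = prod c UNIV"
      by (subst det_diagonal) (auto simp: matrix_def axis_def)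
    then show "?P (\<lambda>x. \<chi> i. c i * x $ i)"
      by (simp add: measurable_stretch measure_stretch)
  next
    fix m n :: 'n assume "m \<noteq> n"
    let ?p = "Transposition.transpose m n"
    let ?h = "\<lambda>x::real^'n. \<chi> i. x $ ?p i"
    have "matrix ?h = (\<chi> i. mat 1 $ ?p i)"
      by (simp add: matrix_def mat_def axis_def vec_eq_iff)
    then have det: "\<bar>det (matrix ?h)\<bar> = 1"
      by (simp add: det_permute_rows permutes_swap_id sign_swap_id \<open>m \<noteq> n\<close>)
    show "?P ?h"
    proof (rule det1[OF _ det])
      show "linear ?h" by (rule linearI) (simp_all add: vec_eq_iff)
      fix a b :: "real^'n" assume ne: "cbox a b \<noteq> {}"
      have "x \<in> ?h ` cbox a b \<longleftrightarrow> x \<in> cbox (?h a) (?h b)" for x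
      proof
        assume x: "x \<in> cbox (?h a) (?h b)"
        have "?h x \<in> cbox a b"
          unfolding mem_box_cart
        proof
          fix i show "a $ i \<le> ?h x $ i \<and> ?h x $ i \<le> b $ i"
            using x[unfolded mem_box_cart, rule_format, of "?p i"] by simp
        qed
        moreover have "x = ?h (?h x)" by (simp add: vec_eq_iff)
        ultimately show "x \<in> ?h ` cbox a b" by blast
      qed (auto simp: mem_box_cart)
      then have eq: "?h ` cbox a b = cbox (?h a) (?h b)" by blast
      then have ne': "cbox (?h a) (?h b) \<noteq> {}" using ne by blast
      have "(\<Prod>i\<in>UNIV. b $ ?p i - a $ ?p i) = (\<Prod>i\<in>UNIV. b $ i - a $ i)"
        using prod.permute[OF permutes_swap_id[of m UNIV n], of "\<lambda>i. b $ i - a $ i"] by (simp add: o_def)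
      then show "measure lebesgue (?h ` cbox a b) = measure lebesgue (cbox a b)"
        using ne ne' by (simp add: eq content_cbox_cart)
    qed
  next
    fix m n :: 'n assume mn: "m \<noteq> n"
    let ?h = "\<lambda>x::real^'n. \<chi> i. if i = m then x $ m + x $ n else x $ i"
    have lin: "linear ?h" by (rule linearI) (auto simp: vec_eq_iff algebra_simps)
    have "matrix ?h = (\<chi> k. if k = m then row m (mat 1) + 1 *s row n (mat 1) else row k (mat 1))"
      by (auto simp: matrix_def mat_def axis_def row_def vec_eq_iff)
    then have det: "\<bar>det (matrix ?h)\<bar> = 1"
      by (simp add: det_row_operation[OF mn])
    show "?P ?h"
    proof (rule det1[OF lin det])
      fix a b :: "real^'n" assume ne: "cbox a b \<noteq> {}"
      define t where "t = axis n (a $ n)"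
      have "cbox a b = (+) t ` cbox (- t + a) (- t + b)"
        by (simp add: cbox_translation[symmetric])
      then have "measure lebesgue (?h ` cbox a b) = measure lebesgue (?h ` cbox (- t + a) (- t + b))"
        by (simp only: linear_image_translation[OF lin] measure_translation)
      also have "\<dots> = measure lebesgue (cbox (- t + a) (- t + b))"
      proof (rule measure_shear_interval[OF mn])
        show "cbox (- t + a) (- t + b) \<noteq> {}"
          using ne by (simp only: cbox_translation image_is_empty) simp
      qed (simp add: t_def)
      also have "\<dots> = measure lebesgue (cbox a b)"
        by (simp only: cbox_translation measure_translation)
      finally show "measure lebesgue (?h ` cbox a b) = measure lebesgue (cbox a b)" .
    qed
  qed
  with S show ?thesis by blast
qed

lemma int_points_Pair [simp]: "(x, y) \<in> int_points \<longleftrightarrow> x \<in> int_points \<and> y \<in> int_points"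
  by (auto simp: int_points_def Basis_prod_def ball_Un)

lemma map_prod_int_points: "map_prod id f ` int_points = int_points \<times> f ` int_points"
proof -
  have "int_points = int_points \<times> int_points" by auto
  then have "map_prod id f ` int_points = map_prod id f ` (int_points \<times> int_points)" by (rule arg_cong)
  then show ?thesis by (simp add: map_prod_def image_paired_Times)
qed

definition unit_cube :: "'a::euclidean_space set" where
  "unit_cube = {z. \<forall>b\<in>Basis. 0 \<le> z \<bullet> b \<and> z \<bullet> b < 1}"

lemma lattice_pair_id: "lattice_pair id id"
  by unfold_locales (simp_all add: linear_id)

lemma lat_id: "lattice_pair.lat id = int_points"
  by (simp add: lattice_pair.lat_def[OF lattice_pair_id])

lemma cell_id: "lattice_pair.cell id = unit_cube"
  by (simp add: lattice_pair.cell_def[OF lattice_pair_id] unit_cube_def)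

lemma lmeasurable_unit_cube: "unit_cube \<in> lmeasurable"
  using lattice_pair.cell_lmeasurable[OF lattice_pair_id] by (simp add: cell_id)

lemma measure_unit_cube: "measure lebesgue (unit_cube :: 'a::euclidean_space set) = 1"
proof (rule antisym)
  have sub: "unit_cube \<subseteq> (cbox 0 One :: 'a set)"
  proof
    fix x :: 'a assume x: "x \<in> unit_cube"
    show "x \<in> cbox 0 One"
      unfolding mem_box
    proof
      fix i :: 'a assume "i \<in> Basis"
      with x show "0 \<bullet> i \<le> x \<bullet> i \<and> x \<bullet> i \<le> One \<bullet> i" by (simp add: unit_cube_def less_imp_le)
    qed
  qed
  have "measure lebesgue (unit_cube :: 'a set) \<le> measure lebesgue (cbox 0 One :: 'a set)"
    using lmeasurable_unit_cube
    by (intro measure_mono_fmeasurable sub) (auto simp: fmeasurableD)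
  then show "measure lebesgue (unit_cube :: 'a set) \<le> 1" by simp
  have "measure lebesgue (box 0 One :: 'a set) \<le> measure lebesgue (unit_cube :: 'a set)"
    using lmeasurable_unit_cube
    by (intro measure_mono_fmeasurable) (auto simp: unit_cube_def mem_box intro: less_imp_le)
  then show "1 \<le> measure lebesgue (unit_cube :: 'a set)" by (simp add: measure_lborel_box_eq)
qed

lemma emeasure_unit_cube: "emeasure lebesgue (unit_cube :: 'a::euclidean_space set) = 1"
  using emeasure_eq_measure2[OF lmeasurable_unit_cube] by (simp only: measure_unit_cube ennreal_1)

lemma unit_cube_unique: "\<exists>!k. k \<in> int_points \<and> z - k \<in> unit_cube"
  using lattice_pair.cell_unique[OF lattice_pair_id] by (simp add: cell_id lat_id)

context lattice_pair begin

lemma cell_eq_image: "cell = a ` unit_cube"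
proof
  show "cell \<subseteq> a ` unit_cube"
  proof
    fix z assume "z \<in> cell"
    then show "z \<in> a ` unit_cube"
      by (intro image_eqI[of _ _ "\<Sum>b\<in>Basis. (z \<bullet> w b) *\<^sub>R b"]) (auto simp: a_coordinates unit_cube_def cell_def)
  qed
qed (auto simp: unit_cube_def cell_def dual)

definition coset_reps :: "'a set" where "coset_reps = lat \<inter> unit_cube"

lemma bij_betw_coset_reps:
  assumes sub: "int_points \<subseteq> lat"
  shows "bij_betw (\<lambda>(k, r). k + r) (int_points \<times> coset_reps) lat"
proof (rule bij_betw_imageI)
  show "inj_on (\<lambda>(k, r). k + r) (int_points \<times> coset_reps)"
  proof (rule inj_onI, clarify)
    fix k r k' r' :: 'a
    assume *: "k \<in> int_points" "r \<in> coset_reps" "k' \<in> int_points" "r' \<in> coset_reps" "k + r = k' + r'"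
    have "k + r - k = r" "k + r - k' = r'"
      using *(5) by (simp_all add: algebra_simps)
    with * have "k + r - k \<in> unit_cube" "k + r - k' \<in> unit_cube"
      by (simp_all only: coset_reps_def Int_iff)
    then have "k = k'" using unit_cube_unique[of "k + r"] * by blast
    with * show "k = k' \<and> r = r'" by simp
  qed
  show "(\<lambda>(k, r). k + r) ` (int_points \<times> coset_reps) = lat"
  proof
    show "lat \<subseteq> (\<lambda>(k, r). k + r) ` (int_points \<times> coset_reps)"
    proof
      fix \<gamma> assume \<gamma>: "\<gamma> \<in> lat"
      obtain k where k: "k \<in> int_points" "\<gamma> - k \<in> unit_cube" using unit_cube_unique by blast
      then have "\<gamma> - k \<in> coset_reps" using \<gamma> sub by (auto simp: coset_reps_def intro: lat_diff)
      with k show "\<gamma> \<in> (\<lambda>(k, r). k + r) ` (int_points \<times> coset_reps)"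
        by (intro image_eqI[of _ _ "(k, \<gamma> - k)"]) auto
    qed
  qed (use sub in \<open>auto simp: coset_reps_def intro: lat_add\<close>)
qed

text \<open>The translates of the cell by the coset representatives make up a fundamental domain of the
  integer lattice, and that lattice has covolume 1.\<close>
lemma card_coset_reps:
  assumes sub: "int_points \<subseteq> lat"
  shows "finite coset_reps" and "covolume * real (card coset_reps) = 1"
proof -
  define T where "T = (\<Union>r\<in>coset_reps. (+) r ` cell)"
  have T: "z \<in> T \<longleftrightarrow> (\<exists>r\<in>coset_reps. z - r \<in> cell)" for z
    by (simp add: T_def mem_translation_iff)
  have T_sets: "T \<in> sets lebesgue"
    unfolding T_def using countable_lat fundamental_domain_sets[OF fundamental_domain_translated_cell]
    by (intro sets.countable_UN') (auto simp: coset_reps_def)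
  have "\<exists>!k. k \<in> int_points \<and> z - k \<in> T" for z
  proof -
    obtain \<gamma> where \<gamma>: "\<gamma> \<in> lat" "z - \<gamma> \<in> cell" and \<gamma>_unique: "\<And>\<gamma>'. \<gamma>' \<in> lat \<Longrightarrow> z - \<gamma>' \<in> cell \<Longrightarrow> \<gamma>' = \<gamma>"
      using cell_unique[of z] by blast
    have "z - k \<in> T \<longleftrightarrow> \<gamma> - k \<in> unit_cube" if k: "k \<in> int_points" for k
    proof
      assume "z - k \<in> T"
      then obtain r where r: "r \<in> coset_reps" "z - k - r \<in> cell" by (auto simp: T)
      then have "k + r = \<gamma>"
        using sub k by (intro \<gamma>_unique) (auto simp: coset_reps_def diff_diff_eq intro: lat_add)
      with r show "\<gamma> - k \<in> unit_cube" by (auto simp: coset_reps_def)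
    next
      assume "\<gamma> - k \<in> unit_cube"
      then have "\<gamma> - k \<in> coset_reps" using \<gamma> k sub by (auto simp: coset_reps_def intro: lat_diff)
      moreover have "z - k - (\<gamma> - k) \<in> cell" using \<gamma> by simp
      ultimately show "z - k \<in> T" unfolding T by blast
    qed
    then show ?thesis using unit_cube_unique[of \<gamma>] by auto
  qed
  then have "fundamental_domain int_points T"
    using T_sets by (simp add: fundamental_domain_def)
  then have "emeasure lebesgue T = 1"
    using lattice_pair.emeasure_fundamental_domain[OF lattice_pair_id, of T]
    by (simp only: lat_id cell_id emeasure_unit_cube)
  moreover have "emeasure lebesgue T = (\<integral>\<^sup>+\<gamma>. emeasure lebesgue (T \<inter> (+) \<gamma> ` cell) \<partial>count_space lat)"
    by (rule emeasure_tiling[OF countable_lat fundamental_domain_cell T_sets])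
  moreover have "\<dots> = (\<integral>\<^sup>+\<gamma>. ennreal covolume * indicator coset_reps \<gamma> \<partial>count_space lat)"
  proof (rule nn_integral_cong)
    fix \<gamma> assume "\<gamma> \<in> space (count_space lat)"
    then have \<gamma>: "\<gamma> \<in> lat" by simp
    have "T \<inter> (+) \<gamma> ` cell = (if \<gamma> \<in> coset_reps then (+) \<gamma> ` cell else {})"
    proof -
      have "x \<in> T \<longleftrightarrow> \<gamma> \<in> coset_reps" if "x - \<gamma> \<in> cell" for x
        unfolding T using \<gamma> that cell_unique[of x] by (auto simp: coset_reps_def)
      then show ?thesis by (auto simp: mem_translation_iff)
    qed
    then show "emeasure lebesgue (T \<inter> (+) \<gamma> ` cell) = ennreal covolume * indicator coset_reps \<gamma>"
      by (simp add: emeasure_lebesgue_translation emeasure_cell)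
  qed
  moreover have "\<dots> = ennreal covolume * emeasure (count_space lat) coset_reps"
    by (subst nn_integral_cmult_indicator) (auto simp: coset_reps_def)
  ultimately have 1: "ennreal covolume * emeasure (count_space lat) coset_reps = 1" by simp
  have le: "coset_reps \<subseteq> lat" by (auto simp: coset_reps_def)
  show fin: "finite coset_reps"
  proof (rule ccontr)
    assume "infinite coset_reps"
    with 1 le covolume_pos show False by (simp add: ennreal_mult_top)
  qed
  have "ennreal (covolume * real (card coset_reps)) = ennreal 1"
    using 1 fin le covolume_pos by (simp add: ennreal_mult ennreal_of_nat_eq_real_of_nat)
  then show "covolume * real (card coset_reps) = 1"
    using covolume_pos by (subst (asm) ennreal_inj) auto
qed

lemma lattice_pair_prod: "lattice_pair (map_prod id a) (map_prod id w)"
proof (rule lattice_pair.intro)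
  show "linear (map_prod id a)" "linear (map_prod id w)"
    using lin_a lin_w by (auto intro!: linearI simp: linear_add linear_scale)
qed (auto simp: dual)

lemma lat_prod: "lattice_pair.lat (map_prod id a) = int_points \<times> lat"
  using map_prod_int_points[of a] by (simp add: lattice_pair.lat_def[OF lattice_pair_prod] lat_def)

lemma dual_lat_prod: "lattice_pair.dual_lat (map_prod id w) = int_points \<times> dual_lat"
  using map_prod_int_points[of w] by (simp add: lattice_pair.dual_lat_def[OF lattice_pair_prod] dual_lat_def)

lemma covolume_prod: "lattice_pair.covolume (map_prod (id :: 'b::euclidean_space \<Rightarrow> 'b) w) = covolume"
proof -
  have cell: "lattice_pair.cell (map_prod (id :: 'b \<Rightarrow> 'b) w) = (unit_cube :: 'b set) \<times> cell"
    unfolding lattice_pair.cell_def[OF lattice_pair_prod] cell_def unit_cube_def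
    using lin_w by (auto simp: Basis_prod_def linear_0 ball_Un)
  have Q: "(unit_cube :: 'b set) \<in> sets borel"
    using lattice_pair.borel_cell[OF lattice_pair_id] by (simp add: cell_id)
  have "emeasure lebesgue ((unit_cube :: 'b set) \<times> cell) = emeasure (lborel \<Otimes>\<^sub>M lborel) ((unit_cube :: 'b set) \<times> cell)"
    using borel_Times[OF Q borel_cell] by (simp add: lborel_prod)
  also have "\<dots> = emeasure lborel (unit_cube :: 'b set) * emeasure lborel cell"
    using Q borel_cell by (intro lborel.emeasure_pair_measure_Times) auto
  also have "\<dots> = emeasure lebesgue (unit_cube :: 'b set) * emeasure lebesgue cell"
    using Q borel_cell by simp
  also have "\<dots> = ennreal covolume"
    by (simp only: emeasure_cell emeasure_unit_cube mult_1)
  finally show ?thesis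
    using covolume_pos unfolding lattice_pair.covolume_def[OF lattice_pair_prod] cell
    by (simp add: measure_def)
qed

end

lemma int_points_eq_int_vecs: "int_points = int_vecs"
  by (auto simp: int_points_def int_vecs_def Basis_vec_def inner_axis)

lemma matrix_inv_mult: "invertible A \<Longrightarrow> matrix_inv A ** A = mat 1"
  unfolding invertible_def matrix_inv_def by (metis (mono_tags, lifting) someI_ex)

context
  fixes B :: "real ^ 'd ^ 'd"
  assumes B: "B \<in> GL_int"
begin

lemma lattice_pair_matrix: "lattice_pair ((*v) (transpose (matrix_inv B))) ((*v) B)"
proof (rule lattice_pair.intro)
  fix x y :: "real ^ 'd"
  have "(transpose (matrix_inv B) *v x) \<bullet> (B *v y) = x \<bullet> ((matrix_inv B ** B) *v y)"
    by (simp add: dot_lmul_matrix matrix_vector_mul_assoc)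
  then show "(transpose (matrix_inv B) *v x) \<bullet> (B *v y) = x \<bullet> y"
    using B by (simp add: GL_int_def matrix_inv_mult)
qed simp_all

lemma int_points_subset_lat: "int_points \<subseteq> lattice_pair.lat ((*v) (transpose (matrix_inv B)))"
proof
  fix z :: "real ^ 'd" assume z: "z \<in> int_points"
  have "B *v b \<in> int_points" if "b \<in> Basis" for b
    using B that by (auto simp: GL_int_def int_points_eq_int_vecs int_vecs_def Basis_vec_def
        matrix_vector_mult_basis column_def)
  with z show "z \<in> lattice_pair.lat ((*v) (transpose (matrix_inv B)))"
    by (auto simp: lattice_pair.lat_iff[OF lattice_pair_matrix] int_points_inner)
qed

lemma covolume_matrix: "lattice_pair.covolume ((*v) B) = 1 / \<bar>det B\<bar>"
proof -
  have "matrix_inv B ** B = mat 1" using B by (simp add: GL_int_def matrix_inv_mult)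
  then have "det (matrix_inv B) * det B = 1" by (metis det_mul det_I)
  then have "\<bar>det (matrix_inv B)\<bar> = 1 / \<bar>det B\<bar>"
    by (metis abs_1 abs_mult eq_divide_eq mult_zero_right zero_neq_one abs_eq_0)
  then show ?thesis
    unfolding lattice_pair.covolume_def[OF lattice_pair_matrix] lattice_pair.cell_eq_image[OF lattice_pair_matrix]
    by (subst measure_linear_image_det) (simp_all add: lmeasurable_unit_cube measure_unit_cube)
qed

end

section \<open>Direct integrals of a constant finite-dimensional field\<close>

lemma cspace_simps:
  "hcarrier (cspace N) = {v. \<forall>i\<ge>N. v i = 0}"
  "hadd (cspace N) = (\<lambda>v w i. v i + w i)"
  "hscale (cspace N) = (\<lambda>c v i. c * v i)"
  "hinner (cspace N) = (\<lambda>v w. \<Sum>i<N. v i * cnj (w i))"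
  by (simp_all add: cspace_def)

lemma hnorm_cspace_sq: "(hnorm (cspace N) v)\<^sup>2 = (\<Sum>i<N. (cmod (v i))\<^sup>2)"
proof -
  have "hinner (cspace N) v v = complex_of_real (\<Sum>i<N. (cmod (v i))\<^sup>2)"
    by (simp only: cspace_simps complex_norm_square of_real_sum)
  then show ?thesis by (simp add: hnorm_def sum_nonneg)
qed

lemma direct_integral_simps:
  "hadd (direct_integral \<mu> (cspace N)) = (\<lambda>F G s i. F s i + G s i)"
  "hscale (direct_integral \<mu> (cspace N)) = (\<lambda>c F s i. c * F s i)"
  "hinner (direct_integral \<mu> (cspace N)) = (\<lambda>F G. LINT s|\<mu>. (\<Sum>i<N. F s i * cnj (G s i)))"
  by (simp_all add: direct_integral_def cspace_simps fun_eq_iff)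

text \<open>Pairing with the unit vectors turns weak measurability into measurability of the components.\<close>
lemma direct_integral_carrier_iff:
  "F \<in> hcarrier (direct_integral \<mu> (cspace N)) \<longleftrightarrow>
    (\<forall>s\<in>space \<mu>. \<forall>i\<ge>N. F s i = 0) \<and> (\<forall>i<N. (\<lambda>s. F s i) \<in> sq_int \<mu>)" (is "?L \<longleftrightarrow> ?R")
proof
  assume F: ?L
  have "(\<lambda>s. F s i) \<in> sq_int \<mu>" if i: "i < N" for i
  proof -
    have "(\<lambda>s. hinner (cspace N) (F s) (\<lambda>j. if j = i then 1 else 0)) \<in> borel_measurable \<mu>"
      using F i by (auto simp: direct_integral_def cspace_simps)
    moreover have "hinner (cspace N) (F s) (\<lambda>j. if j = i then 1 else 0) = F s i" for s
      using i by (simp add: cspace_simps if_distrib sum.delta cong: if_cong)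
    ultimately have meas[measurable]: "(\<lambda>s. F s i) \<in> borel_measurable \<mu>" by simp
    have "integrable \<mu> (\<lambda>s. (cmod (F s i))\<^sup>2)"
    proof (rule Bochner_Integration.integrable_bound)
      show "integrable \<mu> (\<lambda>s. \<Sum>i<N. (cmod (F s i))\<^sup>2)"
        using F by (simp add: direct_integral_def hnorm_cspace_sq)
      show "AE s in \<mu>. norm ((cmod (F s i))\<^sup>2) \<le> norm (\<Sum>i<N. (cmod (F s i))\<^sup>2)"
        using i by (intro AE_I2) (simp add: abs_of_nonneg sum_nonneg, intro member_le_sum, auto)
    qed measurable
    with meas show ?thesis by (simp add: sq_int_iff)
  qed
  with F show ?R by (auto simp: direct_integral_def cspace_simps)
next
  assume R: ?R
  then have "(\<lambda>s. F s i) \<in> borel_measurable \<mu>" "integrable \<mu> (\<lambda>s. (cmod (F s i))\<^sup>2)" if "i < N" for i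
    using that by (auto simp: sq_int_iff)
  with R show ?L
    by (auto simp: direct_integral_def hnorm_cspace_sq cspace_simps
        intro!: borel_measurable_sum borel_measurable_times Bochner_Integration.integrable_sum)
qed

lemma
  assumes F: "F \<in> hcarrier (direct_integral \<mu> (cspace N))" (is "_ \<in> hcarrier ?K")
  shows hnorm_direct_integral_nonneg: "0 \<le> hnorm (direct_integral \<mu> (cspace N)) F"
    and hnorm_direct_integral_sq:
      "(hnorm (direct_integral \<mu> (cspace N)) F)\<^sup>2 = (\<Sum>i<N. (hnorm (L2 \<mu>) (\<lambda>s. F s i))\<^sup>2)"
proof -
  have F_i: "(\<lambda>s. F s i) \<in> sq_int \<mu>" if "i < N" for i
    using F that by (simp add: direct_integral_carrier_iff)
  have "hinner (direct_integral \<mu> (cspace N)) F F = (LINT s|\<mu>. (\<Sum>i<N. F s i * cnj (F s i)))"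
    by (simp add: direct_integral_simps)
  also have "\<dots> = (\<Sum>i<N. ip \<mu> (\<lambda>s. F s i) (\<lambda>s. F s i))"
    unfolding ip_eq using F_i by (intro Bochner_Integration.integral_sum integrable_mult_cnj) auto
  finally have "hinner (direct_integral \<mu> (cspace N)) F F
      = complex_of_real (\<Sum>i<N. (hnorm (L2 \<mu>) (\<lambda>s. F s i))\<^sup>2)"
    by (simp only: ip_self_hnorm of_real_sum)
  then show "0 \<le> hnorm ?K F" "(hnorm ?K F)\<^sup>2 = (\<Sum>i<N. (hnorm (L2 \<mu>) (\<lambda>s. F s i))\<^sup>2)"
    by (simp_all add: hnorm_def[of ?K] sum_nonneg)
qed

lemma heq_direct_integral_iff:
  assumes F: "F \<in> hcarrier (direct_integral \<mu> (cspace N))" and G: "G \<in> hcarrier (direct_integral \<mu> (cspace N))"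
  shows "heq (direct_integral \<mu> (cspace N)) F G \<longleftrightarrow> (\<forall>i<N. AE s in \<mu>. F s i = G s i)"
proof -
  let ?K = "direct_integral \<mu> (cspace N)"
  let ?D = "\<lambda>s i. F s i + -1 * G s i"
  have D_i: "(\<lambda>s. ?D s i) \<in> sq_int \<mu>" if "i < N" for i
    using F G that by (intro sq_int_add sq_int_scale) (auto simp: direct_integral_carrier_iff)
  have D: "?D \<in> hcarrier ?K"
    using F G D_i by (simp add: direct_integral_carrier_iff)
  have "heq ?K F G \<longleftrightarrow> (hnorm ?K ?D)\<^sup>2 = 0"
    unfolding heq_def direct_integral_simps by simp
  also have "\<dots> \<longleftrightarrow> (\<forall>i<N. (hnorm (L2 \<mu>) (\<lambda>s. ?D s i))\<^sup>2 = 0)"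
    unfolding hnorm_direct_integral_sq[OF D] by (subst sum_nonneg_eq_0_iff) auto
  also have "\<dots> \<longleftrightarrow> (\<forall>i<N. AE s in \<mu>. F s i = G s i)"
    using hnorm_L2_eq_0_iff[OF D_i] by simp
  finally show ?thesis .
qed

lemma has_sum_Times_lessThan:
  fixes p :: "'g \<times> nat \<Rightarrow> real"
  assumes "\<And>i. i < N \<Longrightarrow> ((\<lambda>g. p (g, i)) has_sum S i) G"
  shows "(p has_sum (\<Sum>i<N. S i)) (G \<times> {..<N})"
  using assms
proof (induction N)
  case (Suc N)
  have "(p has_sum S N) ((\<lambda>g. (g, N)) ` G)"
    using Suc.prems[of N] by (subst has_sum_reindex) (auto simp: inj_on_def o_def)
  with Suc have "(p has_sum ((\<Sum>i<N. S i) + S N)) (G \<times> {..<N} \<union> (\<lambda>g. (g, N)) ` G)"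
    by (intro has_sum_Un_disjoint) auto
  moreover have "G \<times> {..<N} \<union> (\<lambda>g. (g, N)) ` G = G \<times> {..<Suc N}"
    by (auto simp: less_Suc_eq)
  ultimately show ?case by simp
qed simp

text \<open>Both spaces are identified with the square-summable families on \<open>G \<times> {..<N}\<close>: component \<open>i\<close> of the
  image of \<open>f\<close> is the function whose coefficients are those of \<open>f\<close> along the \<open>i\<close>-th part of the basis.\<close>
lemma unitary_between_bases:
  assumes e: "orthonormal_basis M (G \<times> {..<N}) e" and \<eta>: "orthonormal_basis \<mu> G \<eta>"
  obtains U where "unitary (L2 M) (direct_integral \<mu> (cspace N)) U"
    and "\<And>f g i. f \<in> sq_int M \<Longrightarrow> g \<in> G \<Longrightarrow> i < N \<Longrightarrow> ip \<mu> (\<lambda>s. U f s i) (\<eta> g) = ip M f (e (g, i))"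
proof -
  let ?K = "direct_integral \<mu> (cspace N)"
  have on: "orthonormal M (G \<times> {..<N}) e" and \<eta>on: "orthonormal \<mu> G \<eta>" and G: "countable G"
    and cnt: "countable (G \<times> {..<N})"
    using e \<eta> by (auto simp: orthonormal_basis_def)
  have e_mem: "e (g, i) \<in> sq_int M" if "g \<in> G" "i < N" for g i
    using on that by (auto simp: orthonormal_def)
  have ex: "\<exists>h\<in>sq_int \<mu>. \<forall>g\<in>G. ip \<mu> h (\<eta> g) = ip M f (e (g, i))" if f: "f \<in> sq_int M" and i: "i < N" for f i
  proof -
    have "orthonormal M G (\<lambda>g. e (g, i))"
      using on i by (auto simp: orthonormal_def)
    then have "(\<lambda>g. (cmod (ip M f (e (g, i))))\<^sup>2) summable_on G"
      using f by (rule Bessel)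
    from orthonormal_synthesis[OF \<eta>on G this] show ?thesis by blast
  qed
  define h where "h f i = (SOME h. h \<in> sq_int \<mu> \<and> (\<forall>g\<in>G. ip \<mu> h (\<eta> g) = ip M f (e (g, i))))" for f i
  have h: "h f i \<in> sq_int \<mu> \<and> (\<forall>g\<in>G. ip \<mu> (h f i) (\<eta> g) = ip M f (e (g, i)))" if "f \<in> sq_int M" "i < N" for f i
    using ex[OF that] unfolding h_def Bex_def by (rule someI_ex)
  define U where "U f = (\<lambda>s i. if i < N then h f i s else 0)" for f
  have U_i: "(\<lambda>s. U f s i) = h f i" if "i < N" for f i
    using that by (simp add: U_def)
  have U_coeff: "ip \<mu> (\<lambda>s. U f s i) (\<eta> g) = ip M f (e (g, i))" if "f \<in> sq_int M" "g \<in> G" "i < N" for f g i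
    using h that by (simp add: U_i)
  have U_mem: "(\<lambda>s. U f s i) \<in> sq_int \<mu>" if "f \<in> sq_int M" "i < N" for f i
    using h that by (simp add: U_i)
  have U_carrier: "U f \<in> hcarrier ?K" if "f \<in> sq_int M" for f
    using that U_mem by (simp add: direct_integral_carrier_iff) (simp add: U_def)
  have eqI: "heq ?K (U f) W"
    if f: "f \<in> sq_int M" and W: "W \<in> hcarrier ?K"
      and c: "\<And>g i. g \<in> G \<Longrightarrow> i < N \<Longrightarrow> ip \<mu> (\<lambda>s. W s i) (\<eta> g) = ip M f (e (g, i))" for f W
    unfolding heq_direct_integral_iff[OF U_carrier[OF f] W]
  proof (intro allI impI)
    fix i assume i: "i < N"
    show "AE s in \<mu>. U f s i = W s i"
      using W i by (intro orthonormal_basis_unique[OF \<eta>] U_mem f) (auto simp: direct_integral_carrier_iff U_coeff f c)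
  qed
  have \<eta>_mem: "\<eta> g \<in> sq_int \<mu>" if "g \<in> G" for g
    using \<eta>on that by (simp add: orthonormal_def)
  have "isometry (L2 M) ?K U"
    unfolding isometry_def
  proof (intro conjI ballI allI)
    show "U f \<in> hcarrier ?K" if "f \<in> sq_int M" for f using that by (rule U_carrier)
    show "heq ?K (U (hadd (L2 M) f f')) (hadd ?K (U f) (U f'))" if "f \<in> sq_int M" "f' \<in> sq_int M" for f f'
    proof (rule eqI)
      have add: "hadd (L2 M) f f' = (\<lambda>x. f x + f' x)" by (simp add: L2_def)
      then show "hadd (L2 M) f f' \<in> sq_int M"
        using sq_int_add[OF that] by simp
      show "hadd ?K (U f) (U f') \<in> hcarrier ?K"
        using U_carrier[OF that(1)] U_carrier[OF that(2)]
        by (auto simp: direct_integral_simps direct_integral_carrier_iff intro: sq_int_add)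
      fix g i assume gi: "g \<in> G" "i < N"
      have "ip \<mu> (\<lambda>s. hadd ?K (U f) (U f') s i) (\<eta> g) = ip \<mu> (\<lambda>s. U f s i) (\<eta> g) + ip \<mu> (\<lambda>s. U f' s i) (\<eta> g)"
        unfolding direct_integral_simps using that gi by (intro ip_add_left U_mem \<eta>_mem)
      also have "\<dots> = ip M (hadd (L2 M) f f') (e (g, i))"
        using ip_add_left[OF that e_mem[OF gi]] that gi by (simp add: U_coeff add)
      finally show "ip \<mu> (\<lambda>s. hadd ?K (U f) (U f') s i) (\<eta> g) = ip M (hadd (L2 M) f f') (e (g, i))" .
    qed
    show "heq ?K (U (hscale (L2 M) c f)) (hscale ?K c (U f))" if "f \<in> sq_int M" for c f
    proof (rule eqI)
      show "hscale (L2 M) c f \<in> sq_int M"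
        using sq_int_scale[OF that] by (simp add: L2_def)
      show "hscale ?K c (U f) \<in> hcarrier ?K"
        using U_carrier[OF that]
        by (auto simp: direct_integral_simps direct_integral_carrier_iff intro: sq_int_scale)
      fix g i assume gi: "g \<in> G" "i < N"
      have "hscale (L2 M) c f = (\<lambda>x. c * f x)" by (simp add: L2_def)
      then show "ip \<mu> (\<lambda>s. hscale ?K c (U f) s i) (\<eta> g) = ip M (hscale (L2 M) c f) (e (g, i))"
        using that gi by (simp add: direct_integral_simps ip_scale_left U_coeff)
    qed
    show "hnorm ?K (U f) = hnorm (L2 M) f" if f: "f \<in> sq_int M" for f
    proof -
      have "((\<lambda>g. (cmod (ip M f (e (g, i))))\<^sup>2) has_sum (hnorm (L2 \<mu>) (\<lambda>s. U f s i))\<^sup>2) G" if i: "i < N" for i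
        using Parseval[OF \<eta> U_mem[OF f i]] U_coeff[OF f _ i] by (simp cong: has_sum_cong)
      from has_sum_Times_lessThan[of N "\<lambda>j. (cmod (ip M f (e j)))\<^sup>2", OF this]
      have "(\<Sum>i<N. (hnorm (L2 \<mu>) (\<lambda>s. U f s i))\<^sup>2) = (hnorm (L2 M) f)\<^sup>2"
        using Parseval[OF e f] by (rule has_sum_unique)
      then have sq: "(hnorm ?K (U f))\<^sup>2 = (hnorm (L2 M) f)\<^sup>2"
        by (simp add: hnorm_direct_integral_sq U_carrier f)
      show ?thesis
        by (rule power2_eq_imp_eq[OF sq hnorm_direct_integral_nonneg]) (simp_all add: U_carrier f)
    qed
  qed
  moreover have "\<exists>f\<in>sq_int M. heq ?K (U f) W" if W: "W \<in> hcarrier ?K" for W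
  proof -
    have W_i: "(\<lambda>s. W s i) \<in> sq_int \<mu>" if "i < N" for i
      using W that by (simp add: direct_integral_carrier_iff)
    define c where "c = (\<lambda>(g, i). ip \<mu> (\<lambda>s. W s i) (\<eta> g))"
    have "((\<lambda>j. (cmod (c j))\<^sup>2) has_sum (\<Sum>i<N. (hnorm (L2 \<mu>) (\<lambda>s. W s i))\<^sup>2)) (G \<times> {..<N})"
      using Parseval[OF \<eta> W_i] by (intro has_sum_Times_lessThan) (simp add: c_def)
    then have "(\<lambda>j. (cmod (c j))\<^sup>2) summable_on (G \<times> {..<N})"
      by (rule has_sum_imp_summable)
    from orthonormal_synthesis[OF on cnt this]
    obtain f where "f \<in> sq_int M" "\<forall>j\<in>G \<times> {..<N}. ip M f (e j) = c j" by blast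
    then show ?thesis
      using W by (intro bexI[of _ f] eqI) (auto simp: c_def)
  qed
  ultimately have "unitary (L2 M) ?K U"
    by (simp add: unitary_def)
  with U_coeff show ?thesis by (intro that)
qed

section \<open>The Gabor representation\<close>

lemma distr_lebesgue_translation:
  "distr lebesgue lebesgue ((+) t) = (lebesgue :: 'a::euclidean_space measure)"
  and measurable_lebesgue_translation: "(+) t \<in> (lebesgue :: 'a measure) \<rightarrow>\<^sub>M lebesgue"
proof -
  have T: "(\<lambda>x. t + (\<Sum>j\<in>Basis. (1 * (x \<bullet> j)) *\<^sub>R j)) = (+) t"
    by (simp add: euclidean_representation)
  show "distr lebesgue lebesgue ((+) t) = (lebesgue :: 'a measure)"
    using lebesgue_affine_euclidean[of "\<lambda>_. 1" t] unfolding T by (simp add: density_1)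
  show "(+) t \<in> (lebesgue :: 'a measure) \<rightarrow>\<^sub>M lebesgue"
    using lebesgue_affine_measurable[of "\<lambda>_. 1" t] unfolding T by simp
qed

lemma measurable_translate:
  "f \<in> borel_measurable lebesgue \<Longrightarrow> (\<lambda>x. f (x - t)) \<in> borel_measurable (lebesgue :: 'a::euclidean_space measure)"
  using measurable_compose[OF measurable_lebesgue_translation[of "- t"]] by simp

lemma integral_translate:
  fixes f :: "'a::euclidean_space \<Rightarrow> complex"
  assumes "f \<in> borel_measurable lebesgue"
  shows "(LINT x|lebesgue. f (x - t)) = (LINT x|lebesgue. f x)"
  using integral_distr[OF measurable_lebesgue_translation[of "- t"] assms]
  by (simp add: distr_lebesgue_translation)

lemma integrable_translate:
  fixes f :: "'a::euclidean_space \<Rightarrow> real"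
  assumes "integrable lebesgue f"
  shows "integrable lebesgue (\<lambda>x. f (x - t))"
  using integrable_distr[OF measurable_lebesgue_translation[of "- t"], of f] assms
  by (simp add: distr_lebesgue_translation)

text \<open>A lattice that contains the integer points has a dual lattice of integer frequencies. So the
  modulations in question are invariant under integer translations, and the Gabor representation is
  a representation of an abelian group.\<close>
locale gabor_lattice = lattice_pair a w for a w :: "real ^ 'd \<Rightarrow> real ^ 'd" +
  assumes int_points_subset: "int_points \<subseteq> lat"
begin

definition group :: "((real ^ 'd) \<times> (real ^ 'd)) set" where
  "group = int_points \<times> dual_lat"

definition index :: nat where "index = card coset_reps"

definition rep :: "nat \<Rightarrow> real ^ 'd" where
  "rep = (SOME r. bij_betw r {..<index} coset_reps)"

lemma bij_betw_rep: "bij_betw rep {..<index} coset_reps"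
  unfolding rep_def index_def
  using ex_bij_betw_nat_finite[OF card_coset_reps(1)[OF int_points_subset]]
  unfolding atLeast0LessThan by (rule someI_ex)

text \<open>The normalised indicator of the cell at the \<open>i\<close>-th coset representative.\<close>
definition window :: "nat \<Rightarrow> real ^ 'd \<Rightarrow> complex" where
  "window i = wave_packet (rep i, 0)"

lemma window_sq_int: "window i \<in> sq_int lebesgue"
  by (simp add: window_def wave_packet_sq_int)

lemma group_0: "(0, 0) \<in> group"
  and group_minus: "(k, l) \<in> group \<Longrightarrow> (- k, - l) \<in> group"
  and group_diff: "(k, l) \<in> group \<Longrightarrow> (k', l') \<in> group \<Longrightarrow> (k - k', l - l') \<in> group"
  by (simp_all add: group_def int_points_0 int_points_minus int_points_diff dual_lat_0 dual_lat_minus dual_lat_diff)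

lemma countable_group: "countable group"
  by (simp add: group_def countable_int_points countable_dual_lat)

lemma gabor_rep_eq:
  assumes "(k, l) \<in> group"
  shows "gabor_rep (k, l) f = (\<lambda>x. wave l x * f (x - k))"
proof -
  have "wave l (x - k) = wave l x" for x
    using assms int_points_subset wave_periodic by (auto simp: group_def)
  then show ?thesis
    by (simp add: gabor_rep_def translation_def modulation_def wave_def)
qed

lemma gabor_rep_sq_int:
  assumes g: "g \<in> group" and f: "f \<in> sq_int lebesgue"
  shows "gabor_rep g f \<in> sq_int lebesgue"
proof -
  obtain k l where kl: "g = (k, l)" by (cases g)
  have "(\<lambda>x. wave l x * f (x - k)) \<in> borel_measurable lebesgue"
    using f lebesgue_measurable_wave by (intro borel_measurable_times measurable_translate) (auto simp: sq_int_iff)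
  moreover have "integrable lebesgue (\<lambda>x. (cmod (wave l x * f (x - k)))\<^sup>2)"
    using f integrable_translate[of "\<lambda>x. (cmod (f x))\<^sup>2" k] by (simp add: sq_int_iff norm_mult)
  ultimately show ?thesis
    using g by (simp add: kl gabor_rep_eq sq_int_iff)
qed

lemma gabor_rep_adjoint:
  assumes g: "(k, l) \<in> group" and f: "f \<in> sq_int lebesgue" and h: "h \<in> sq_int lebesgue"
  shows "ip lebesgue (gabor_rep (k, l) f) h = ip lebesgue f (gabor_rep (- k, - l) h)"
proof -
  have k: "- k \<in> lat" and l: "l \<in> dual_lat"
    using g int_points_subset int_points_minus by (auto simp: group_def)
  let ?F = "\<lambda>x. f x * (wave l x * cnj (h (x + k)))"
  have "?F \<in> borel_measurable lebesgue"
    using f h lebesgue_measurable_wave measurable_translate[of h "- k"]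
    by (intro borel_measurable_times borel_measurable_cnj) (auto simp: sq_int_iff)
  from integral_translate[OF this, of k]
  have "(LINT x|lebesgue. f (x - k) * (wave l (x - k) * cnj (h x))) = (LINT x|lebesgue. ?F x)"
    by simp
  moreover have "wave l (x - k) = wave l x" for x
    using wave_periodic[OF l, of k] g int_points_subset by (auto simp: group_def)
  ultimately show ?thesis
    unfolding ip_eq gabor_rep_eq[OF g] gabor_rep_eq[OF group_minus[OF g]]
    by (simp add: wave_minus_left mult_ac)
qed

lemma gabor_rep_compose:
  assumes "(k, l) \<in> group" "(k', l') \<in> group"
  shows "gabor_rep (- k, - l) (gabor_rep (k', l') f) = gabor_rep (k' - k, l' - l) f"
proof -
  have "wave l' (x + k) = wave l' x" for x
    using assms int_points_subset wave_periodic[of l' "- k" x] int_points_minus[of k] by (auto simp: group_def)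
  then show ?thesis
    unfolding gabor_rep_eq[OF group_minus[OF assms(1)]] gabor_rep_eq[OF assms(2)]
      gabor_rep_eq[OF group_diff[OF assms(2,1)]]
    by (auto simp: wave_diff_left wave_minus_left diff_diff_eq2 add.commute[of k] algebra_simps)
qed

lemma gabor_rep_window: "(k, l) \<in> group \<Longrightarrow> gabor_rep (k, l) (window i) = wave_packet (k + rep i, l)"
  by (auto simp: gabor_rep_eq window_def wave_packet_def diff_diff_eq)

text \<open>The windows sit at representatives of the cosets of the integer points, so integer translations
  carry them to every lattice translate of the cell exactly once.\<close>
lemma orthonormal_basis_gabor:
  "orthonormal_basis lebesgue (group \<times> {..<index}) (\<lambda>(g, i). gabor_rep g (window i))"
proof (rule orthonormal_basis_reindex[OF orthonormal_basis_wave_packets])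
  show "bij_betw (\<lambda>((k, l), i). (k + rep i, l)) (group \<times> {..<index}) (lat \<times> dual_lat)"
  proof (rule bij_betw_imageI)
    note bij = bij_betw_coset_reps[OF int_points_subset]
    show "inj_on (\<lambda>((k, l), i). (k + rep i, l)) (group \<times> {..<index})"
    proof (rule inj_onI)
      fix x y assume x: "x \<in> group \<times> {..<index}" and y: "y \<in> group \<times> {..<index}"
        and xy: "(\<lambda>((k, l), i). (k + rep i, l)) x = (\<lambda>((k, l), i). (k + rep i, l)) y"
      obtain k l i k' l' i' where x_eq: "x = ((k, l), i)" and y_eq: "y = ((k', l'), i')"
        by (metis prod.exhaust)
      have *: "(k, l) \<in> group" "(k', l') \<in> group" "i \<in> {..<index}" "i' \<in> {..<index}"
        "k + rep i = k' + rep i'" "l = l'"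
        using x y xy by (auto simp: x_eq y_eq)
      have "rep i \<in> coset_reps" "rep i' \<in> coset_reps"
        using * bij_betwE[OF bij_betw_rep] by auto
      then have "(k, rep i) = (k', rep i')"
        using * by (intro inj_onD[OF bij_betw_imp_inj_on[OF bij]]) (auto simp: group_def)
      moreover from this have "i = i'"
        using * by (intro inj_onD[OF bij_betw_imp_inj_on[OF bij_betw_rep]]) auto
      ultimately show "x = y" using *(6) by (simp add: x_eq y_eq)
    qed
    show "(\<lambda>((k, l), i). (k + rep i, l)) ` (group \<times> {..<index}) = lat \<times> dual_lat"
    proof
      show "(\<lambda>((k, l), i). (k + rep i, l)) ` (group \<times> {..<index}) \<subseteq> lat \<times> dual_lat"
        using bij_betwE[OF bij_betw_rep] int_points_subset
        by (force simp: group_def coset_reps_def intro: lat_add)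
      show "lat \<times> dual_lat \<subseteq> (\<lambda>((k, l), i). (k + rep i, l)) ` (group \<times> {..<index})"
      proof clarify
        fix \<gamma> l assume \<gamma>: "\<gamma> \<in> lat" and l: "l \<in> dual_lat"
        from \<gamma> obtain k r where kr: "k \<in> int_points" "r \<in> coset_reps" "\<gamma> = k + r"
          using bij_betw_imp_surj_on[OF bij] by force
        then obtain i where "i < index" "r = rep i"
          using bij_betw_imp_surj_on[OF bij_betw_rep] by force
        with kr l show "(\<gamma>, l) \<in> (\<lambda>((k, l), i). (k + rep i, l)) ` (group \<times> {..<index})"
          by (intro image_eqI[of _ _ "((k, l), i)"]) (auto simp: group_def)
      qed
    qed
  qed
qed (auto simp: gabor_rep_window countable_group)

text \<open>The squares of the coefficients of \<open>\<phi>\<close> along the orthonormal basis are summed in two ways. In total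
  they give the squared norm of \<open>\<phi>\<close>. For a fixed window, unitarity and inversion in the group turn
  the sum over the group into the frame expansion of that window, which is 1. Hence the squared
  norm of \<open>\<phi>\<close> is the index. But the frame expansion of \<open>\<phi>\<close> contains the square of its squared norm
  as the term of the neutral element, so the squared norm is at most 1.\<close>
lemma no_parseval_generator:
  assumes index: "index \<ge> 2" and \<phi>: "\<phi> \<in> sq_int lebesgue"
    and parseval: "\<And>f. f \<in> sq_int lebesgue \<Longrightarrow>
      ((\<lambda>g. (cmod (ip lebesgue f (gabor_rep g \<phi>)))\<^sup>2) has_sum (hnorm (L2 lebesgue) f)\<^sup>2) group"
  shows False
proof -
  let ?n = "\<lambda>f. (hnorm (L2 (lebesgue :: (real ^ 'd) measure)) f)\<^sup>2"
  have bij: "bij_betw uminus group group"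
    by (rule bij_betwI[of _ _ _ uminus]) (auto simp: group_minus)
  have "((\<lambda>g. (cmod (ip lebesgue \<phi> (gabor_rep g (window i))))\<^sup>2) has_sum 1) group" if i: "i < index" for i
  proof -
    have "gabor_rep (0, 0) (window i) = window i" by (simp add: gabor_rep_eq group_0)
    then have "ip lebesgue (window i) (window i) = 1"
      using orthonormal_basis_gabor i group_0 unfolding orthonormal_basis_def orthonormal_def by force
    then have "?n (window i) = 1" by (simp only: ip_self_hnorm of_real_eq_1_iff)
    with parseval[OF window_sq_int, of i]
    have "((\<lambda>g. (cmod (ip lebesgue (window i) (gabor_rep g \<phi>)))\<^sup>2) has_sum 1) group" by simp
    then have "((\<lambda>g. (cmod (ip lebesgue (window i) (gabor_rep (- g) \<phi>)))\<^sup>2) has_sum 1) group"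
      by (subst has_sum_reindex_bij_betw[OF bij, of "\<lambda>g. (cmod (ip lebesgue (window i) (gabor_rep g \<phi>)))\<^sup>2"])
    moreover have "cmod (ip lebesgue (window i) (gabor_rep (- g) \<phi>)) = cmod (ip lebesgue \<phi> (gabor_rep g (window i)))"
      if "g \<in> group" for g
      using that gabor_rep_adjoint[of "fst g" "snd g" "window i" \<phi>] window_sq_int \<phi>
        ip_commute[of lebesgue \<phi> "gabor_rep g (window i)"] by (cases g) simp
    ultimately show ?thesis by (simp cong: has_sum_cong)
  qed
  then have "((\<lambda>(g, i). (cmod (ip lebesgue \<phi> (gabor_rep g (window i))))\<^sup>2) has_sum (\<Sum>i<index. 1))
      (group \<times> {..<index})"
    by (intro has_sum_Times_lessThan) simp
  with Parseval[OF orthonormal_basis_gabor \<phi>] have norm: "?n \<phi> = real index"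
    by (auto simp: case_prod_beta' intro: has_sum_unique)
  have "(cmod (ip lebesgue \<phi> (gabor_rep (0, 0) \<phi>)))\<^sup>2
      = (\<Sum>g\<in>{(0, 0)}. (cmod (ip lebesgue \<phi> (gabor_rep g \<phi>)))\<^sup>2)" by simp
  also have "\<dots> \<le> ?n \<phi>"
    by (rule has_sum_mono_neutral[OF has_sum_finite parseval[OF \<phi>]]) (auto simp: group_0)
  finally have "(cmod (ip lebesgue \<phi> (gabor_rep (0, 0) \<phi>)))\<^sup>2 \<le> ?n \<phi>" .
  moreover have "gabor_rep (0, 0) \<phi> = \<phi>" by (simp add: gabor_rep_eq group_0)
  moreover have "cmod (ip lebesgue \<phi> \<phi>) = ?n \<phi>"
    unfolding ip_self_hnorm norm_of_real by simp
  ultimately have "(?n \<phi>)\<^sup>2 \<le> ?n \<phi>" by (simp only:)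
  with norm index show False
    by (simp add: power2_eq_square)
qed

end

lemma has_sum_count_space:
  fixes p :: "'g \<Rightarrow> real"
  assumes "integrable (count_space G) p"
  shows "(p has_sum (LINT x|count_space G. p x)) G"
proof -
  have p: "Infinite_Set_Sum.abs_summable_on p G"
    using assms by (simp add: Infinite_Set_Sum.abs_summable_on_def)
  then have "p summable_on G"
    using abs_summable_equivalent abs_summable_summable by blast
  moreover have "infsum p G = (LINT x|count_space G. p x)"
    using infsetsum_infsum[OF p] by (simp add: infsetsum_def)
  ultimately show ?thesis by (metis has_sum_infsum)
qed

lemma admissible_L2_has_sum:
  assumes "isometry (L2 M) (L2 (count_space G)) (\<lambda>f g. ip M f (\<pi> g \<phi>))" and f: "f \<in> sq_int M"
  shows "((\<lambda>g. (cmod (ip M f (\<pi> g \<phi>)))\<^sup>2) has_sum (hnorm (L2 M) f)\<^sup>2) G"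
proof -
  have "(\<lambda>g. ip M f (\<pi> g \<phi>)) \<in> sq_int (count_space G)"
    and norm: "hnorm (L2 (count_space G)) (\<lambda>g. ip M f (\<pi> g \<phi>)) = hnorm (L2 M) f"
    using assms by (auto simp: isometry_def)
  then have "integrable (count_space G) (\<lambda>g. (cmod (ip M f (\<pi> g \<phi>)))\<^sup>2)"
    by (simp add: sq_int_iff)
  from has_sum_count_space[OF this] show ?thesis
    unfolding norm[symmetric] hnorm_L2_sq .
qed

theorem proposition4p2:
  fixes B :: "real ^ 'd ^ 'd"
    and \<Lambda> :: "((real ^ 'd) \<times> (real ^ 'd)) set"
  assumes "B \<in> GL_int"
    and "\<bar>det B\<bar> \<noteq> 1"
    and "fundamental_domain (dual_lattice B) \<Lambda>"
  shows "\<not> admissible (count_space (gabor_group B)) (L2 lebesgue) gabor_rep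
    \<and> \<not> (\<exists>f \<in> hcarrier (L2 lebesgue).
           parseval_frame (L2 lebesgue) (gabor_group B) (\<lambda>g. gabor_rep g f))
    \<and> unitarily_equivalent (gabor_group B)
        (L2 lebesgue) gabor_rep
        (direct_integral (plancherel_measure B \<Lambda>) (cspace (abs_det B)))
        (direct_integral_rep
           (\<lambda>s. character_tensor_one (cspace (abs_det B)) (character s)))"
proof -
  let ?a = "(*v) (transpose (matrix_inv B))" and ?w = "(*v) B"
  interpret lattice_pair ?a ?w
    by (rule lattice_pair_matrix[OF assms(1)])
  interpret gabor_lattice ?a ?w
    by unfold_locales (rule int_points_subset_lat[OF assms(1)])
  interpret prod: lattice_pair "map_prod (id :: real ^ 'd \<Rightarrow> _) ?a" "map_prod (id :: real ^ 'd \<Rightarrow> _) ?w"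
    by (rule lattice_pair_prod)
  have group: "gabor_group B = group"
    by (simp add: gabor_group_def group_def dual_lat_def int_points_eq_int_vecs)
  have covol: "covolume = 1 / \<bar>det B\<bar>"
    by (rule covolume_matrix[OF assms(1)])
  have det: "\<bar>det B\<bar> = real index"
    using card_coset_reps(2)[OF int_points_subset] covolume_pos covol
    by (simp add: index_def field_simps)
  have N: "abs_det B = index"
    by (simp add: abs_det_def det)
  have index: "index \<ge> 2"
    using assms(2) covolume_pos covol det by (cases index) auto
  have \<Lambda>: "fundamental_domain prod.lat \<Lambda>"
    using assms(3) by (simp add: dual_lattice_def lat_prod lat_def int_points_eq_int_vecs)
  have \<mu>: "plancherel_measure B \<Lambda> = scale_measure (ennreal (1 / prod.covolume)) (lebesgue_on \<Lambda>)"
    by (simp add: plancherel_measure_def covolume_prod covol)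
  \<comment> \<open>The characters of the group are the waves of the product lattice, with the two variables exchanged.\<close>
  have basis: "orthonormal_basis (plancherel_measure B \<Lambda>) group wave"
    using prod.orthonormal_basis_waves[OF \<Lambda>] by (simp add: \<mu> dual_lat_prod group_def)
  let ?\<mu> = "plancherel_measure B \<Lambda>"
  let ?K = "direct_integral ?\<mu> (cspace index)"
  let ?\<rho> = "direct_integral_rep (\<lambda>s. character_tensor_one (cspace index) (character s))"
  have wave_mem: "wave g \<in> sq_int ?\<mu>" if "g \<in> group" for g
    using basis that by (simp add: orthonormal_basis_def orthonormal_def)
  have \<rho>: "?\<rho> g F = (\<lambda>s i. wave g s * F s i)" for g F
    by (cases g) (auto simp: direct_integral_rep_def character_tensor_one_def cspace_simps
        character_def wave_def inner_commute split: prod.splits)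
  have "\<not> admissible (count_space group) (L2 lebesgue) gabor_rep"
    using no_parseval_generator[OF index] admissible_L2_has_sum[where \<pi> = gabor_rep and M = lebesgue and G = group]
    unfolding admissible_def by blast
  moreover have "\<not> (\<exists>f \<in> hcarrier (L2 lebesgue). parseval_frame (L2 lebesgue) group (\<lambda>g. gabor_rep g f))"
    using no_parseval_generator[OF index] unfolding parseval_frame_def by blast
  moreover have "unitarily_equivalent group (L2 lebesgue) gabor_rep ?K ?\<rho>"
  proof -
    obtain U where U: "unitary (L2 lebesgue) ?K U"
      and coeff: "\<And>f g i. f \<in> sq_int lebesgue \<Longrightarrow> g \<in> group \<Longrightarrow> i < index \<Longrightarrow>
        ip ?\<mu> (\<lambda>s. U f s i) (wave g) = ip lebesgue f (gabor_rep g (window i))"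
      using unitary_between_bases[OF orthonormal_basis_gabor basis] by auto
    have U_carrier: "U f \<in> hcarrier ?K" if "f \<in> sq_int lebesgue" for f
      using U that by (simp add: unitary_def isometry_def)
    have "heq ?K (U (gabor_rep g f)) (?\<rho> g (U f))" if g: "g \<in> group" and f: "f \<in> sq_int lebesgue" for g f
    proof -
      obtain k l where kl: "g = (k, l)" by (cases g)
      have gf: "gabor_rep g f \<in> sq_int lebesgue" using g f by (rule gabor_rep_sq_int)
      have U_i: "(\<lambda>s. U f s i) \<in> sq_int ?\<mu>" if "i < index" for i
        using U_carrier[OF f] that by (simp add: direct_integral_carrier_iff)
      have mult_mem: "(\<lambda>s. wave g s * U f s i) \<in> sq_int ?\<mu>" if "i < index" for i
        using U_i[OF that] wave_mem[OF g] by (auto simp: sq_int_iff norm_mult intro: borel_measurable_times)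
      have \<rho>_carrier: "?\<rho> g (U f) \<in> hcarrier ?K"
        using mult_mem U_carrier[OF f] unfolding \<rho> by (simp add: direct_integral_carrier_iff)
      have "AE s in ?\<mu>. U (gabor_rep g f) s i = wave g s * U f s i" if i: "i < index" for i
      proof (rule orthonormal_basis_unique[OF basis])
        show "(\<lambda>s. U (gabor_rep g f) s i) \<in> sq_int ?\<mu>"
          using U_carrier[OF gf] i by (simp add: direct_integral_carrier_iff)
        show "(\<lambda>s. wave g s * U f s i) \<in> sq_int ?\<mu>" by (rule mult_mem[OF i])
        fix g' assume g': "g' \<in> group"
        obtain k' l' where kl': "g' = (k', l')" by (cases g')
        have d: "g' - g \<in> group" using g g' group_diff by (simp add: kl kl')
        have "ip ?\<mu> (\<lambda>s. U (gabor_rep g f) s i) (wave g') = ip lebesgue (gabor_rep g f) (gabor_rep g' (window i))"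
          by (rule coeff[OF gf g' i])
        also have "\<dots> = ip lebesgue f (gabor_rep (- k, - l) (gabor_rep g' (window i)))"
          using g unfolding kl by (rule gabor_rep_adjoint[OF _ f gabor_rep_sq_int[OF g' window_sq_int]])
        also have "\<dots> = ip lebesgue f (gabor_rep (g' - g) (window i))"
          using g g' by (simp add: kl kl' gabor_rep_compose)
        also have "\<dots> = ip ?\<mu> (\<lambda>s. U f s i) (wave (g' - g))"
          by (rule coeff[OF f d i, symmetric])
        also have "\<dots> = ip ?\<mu> (\<lambda>s. wave g s * U f s i) (wave g')"
          by (simp add: ip_eq wave_diff_left mult_ac)
        finally show "ip ?\<mu> (\<lambda>s. U (gabor_rep g f) s i) (wave g') = ip ?\<mu> (\<lambda>s. wave g s * U f s i) (wave g')" .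
      qed
      then show ?thesis
        using heq_direct_integral_iff[OF U_carrier[OF gf] \<rho>_carrier] by (simp add: \<rho>)
    qed
    with U show ?thesis
      unfolding unitarily_equivalent_def by blast
  qed
  ultimately show ?thesis
    unfolding group N by blast
qed

end
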